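(* There exists an absolute constant $c>0$ such that for every integer $n\ge1$ and every $1\le k\le n$ there is a unital $k$-positive map $\Phi:M_n\to M_n$ with $\|\Phi\|_{cb}\ge c\sqrt{n/k}$. In particular $d_k(M_n)\ge c\sqrt{n/k}$.
   Context: $\|\Phi\|_{cb}=\sup_m\|\mathrm{id}_m\otimes\Phi\|$ (operator norms). $d_k(\mathcal S)=\sup\{\|\phi\|_{cb}:\phi:\mathcal S\to\mathcal T\text{ unital and }k\text{-positive},\ \mathcal T\text{ any operator system}\}$, where $k$-positive means $\mathrm{id}_k\otimes\phi$ is positive. *)

theory Defs
  imports Complex_Main "HOL-Library.Extended_Real" "Jordan_Normal_Form.Matrix"
begin

definition quad_form :: "complex mat \<Rightarrow> complex vec \<Rightarrow> complex" where
  "quad_form A v = (\<Sum>i<dim_row A. \<Sum>j<dim_col A. cnj (v $ i) * A $$ (i, j) * v $ j)"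

definition psd_mat :: "nat \<Rightarrow> complex mat \<Rightarrow> bool" where
  "psd_mat m A \<longleftrightarrow> A \<in> carrier_mat m m \<and>
     (\<forall>v \<in> carrier_vec m. Im (quad_form A v) = 0 \<and> Re (quad_form A v) \<ge> 0)"

definition vnorm :: "complex vec \<Rightarrow> real" where
  "vnorm v = sqrt (\<Sum>i<dim_vec v. (cmod (v $ i))\<^sup>2)"

definition op_norm :: "complex mat \<Rightarrow> real" where
  "op_norm A = Sup {vnorm (A *\<^sub>v v) | v. v \<in> carrier_vec (dim_col A) \<and> vnorm v \<le> 1}"

definition block :: "nat \<Rightarrow> complex mat \<Rightarrow> nat \<Rightarrow> nat \<Rightarrow> complex mat" where
  "block n X i j = mat n n (\<lambda>(r, s). X $$ (i * n + r, j * n + s))"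

text \<open>The ampliation \<open>id_k \<otimes> \<Phi>\<close> acting on M_k(M_n) = M_{kn}, applying \<Phi> blockwise.\<close>
definition ampl :: "nat \<Rightarrow> nat \<Rightarrow> (complex mat \<Rightarrow> complex mat) \<Rightarrow> complex mat \<Rightarrow> complex mat" where
  "ampl k n \<Phi> X = mat (k * n) (k * n)
     (\<lambda>(a, b). \<Phi> (block n X (a div n) (b div n)) $$ (a mod n, b mod n))"

definition linear_map_Mn :: "nat \<Rightarrow> (complex mat \<Rightarrow> complex mat) \<Rightarrow> bool" where
  "linear_map_Mn n \<Phi> \<longleftrightarrow>
     (\<forall>X \<in> carrier_mat n n. \<Phi> X \<in> carrier_mat n n) \<and>
     (\<forall>X \<in> carrier_mat n n. \<forall>Y \<in> carrier_mat n n. \<forall>a :: complex.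
        \<Phi> (a \<cdot>\<^sub>m X + Y) = a \<cdot>\<^sub>m \<Phi> X + \<Phi> Y)"

definition unital_Mn :: "nat \<Rightarrow> (complex mat \<Rightarrow> complex mat) \<Rightarrow> bool" where
  "unital_Mn n \<Phi> \<longleftrightarrow> \<Phi> (1\<^sub>m n) = 1\<^sub>m n"

definition k_positive_Mn :: "nat \<Rightarrow> nat \<Rightarrow> (complex mat \<Rightarrow> complex mat) \<Rightarrow> bool" where
  "k_positive_Mn k n \<Phi> \<longleftrightarrow>
     (\<forall>X. psd_mat (k * n) X \<longrightarrow> psd_mat (k * n) (ampl k n \<Phi> X))"

text \<open>Norm of \<open>id_m \<otimes> \<Phi>\<close>, and the cb-norm as supremum over m (in ereal, so it is meaningful
  even without a priori boundedness).\<close>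
definition ampl_norm :: "nat \<Rightarrow> nat \<Rightarrow> (complex mat \<Rightarrow> complex mat) \<Rightarrow> ereal" where
  "ampl_norm m n \<Phi> = (SUP X \<in> {X \<in> carrier_mat (m * n) (m * n). op_norm X \<le> 1}.
                        ereal (op_norm (ampl m n \<Phi> X)))"

definition cb_norm :: "nat \<Rightarrow> (complex mat \<Rightarrow> complex mat) \<Rightarrow> ereal" where
  "cb_norm n \<Phi> = (SUP m \<in> {1..}. ampl_norm m n \<Phi>)"

end

theory Submission
  imports Defs "HOL-Library.FuncSet" "HOL-Analysis.L2_Norm"
begin

text \<open>
  Put \<open>p = n div 2\<close> and let \<open>\<Phi> X = (tr X / n) 1 + s (\<Sum>a b. X\<^sub>a\<^sub>,\<^sub>p\<^sub>+\<^sub>b G\<^sub>a\<^sub>b + X\<^sub>p\<^sub>+\<^sub>b\<^sub>,\<^sub>a G\<^sub>a\<^sub>b\<^sup>*)\<close> with \<open>p \<times> p\<close> sign matrices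
  \<open>G\<^sub>a\<^sub>b\<close>. Only an off-diagonal corner of \<open>X\<close> enters the second term, so \<open>\<Phi>\<close> is unital.
  Testing on rank-one matrices, \<open>\<Phi>\<close> is \<open>k\<close>-positive as soon as the form
  \<open>\<Sum> \<epsilon> u\<^sub>a\<^sub>c w\<^sub>b\<^sub>d\<close> of the signs \<open>\<epsilon>\<close> is at most \<open>1 / (s n)\<close> on unit-norm \<open>p \<times> p\<close> matrices \<open>u\<close>, \<open>w\<close> of rank at
  most \<open>k\<close>. For suitable signs this form is \<open>O(\<surd>(k p))\<close> in rank \<open>k\<close> and simultaneously \<open>O(p)\<close>
  without rank restriction. The second bound says that \<open>\<epsilon> / O(p)\<close>, arranged as a block matrix, is a
  contraction; \<open>id \<otimes> \<Phi>\<close> pairs it with the \<open>G\<^sub>a\<^sub>b\<close> without cancellation, and the maximally entangled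
  vector detects the value \<open>s p\<^sup>3 / O(p)\<close>, of order \<open>\<surd>(n / k)\<close>.

  The rank-\<open>k\<close> bound is a union bound over integer points. By bilinearity it is not necessary to
  approximate \<open>u\<close>; it suffices to write it as a mean of lattice matrices of comparable norm, which
  rounding the two factors of \<open>u\<close> coordinatewise achieves.
\<close>

section \<open>Choosing signs\<close>

text \<open>A random sign is sub-Gaussian. For \<open>0 <= x <= 1\<close> the two exponentials lie
  below \<open>1 + x + x^2\<close> and \<open>1 - x + x^2\<close>, the latter because
  \<open>(1 - x + x^2) (1 + x) = 1 + x^3\<close>; for \<open>x > 1\<close> each lies below
  \<open>exp (x^2)\<close>.\<close>

lemma exp_add_exp_minus_le:
  fixes x :: real
  shows "exp x + exp (- x) \<le> 2 * exp (x\<^sup>2)"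
proof -
  have *: "exp x + exp (- x) \<le> 2 * exp (x\<^sup>2)" if "x \<ge> 0" for x :: real
  proof (cases "x \<le> 1")
    case True
    have "1 \<le> (1 - x + x\<^sup>2) * (1 + x)"
      using that by (simp add: algebra_simps power2_eq_square)
    also have "\<dots> \<le> (1 - x + x\<^sup>2) * exp x"
      using True that exp_ge_add_one_self[of x] by (intro mult_left_mono) auto
    finally have "exp (- x) \<le> 1 - x + x\<^sup>2"
      by (simp add: exp_minus field_simps)
    moreover have "exp x \<le> 1 + x + x\<^sup>2"
      using exp_bound[OF that True] .
    ultimately show ?thesis
      using exp_ge_add_one_self[of "x\<^sup>2"] by linarith
  next
    case False
    then have "x \<le> x\<^sup>2"
      by (simp add: power2_eq_square)
    moreover have "- x \<le> x\<^sup>2"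
      using that by (meson dual_order.trans neg_le_0_iff_le zero_le_power2)
    ultimately have "exp x \<le> exp (x\<^sup>2)" "exp (- x) \<le> exp (x\<^sup>2)"
      by auto
    then show ?thesis
      by linarith
  qed
  show ?thesis
    using *[of x] *[of "- x"] by (cases "x \<ge> 0") (auto simp: add.commute)
qed

text \<open>Method of conditional expectations: the signs are chosen one at a time, each choice doing at
  least as well as the average of the two.\<close>

lemma exists_signs_exp_moment_le:
  fixes c :: "'q \<Rightarrow> 't \<Rightarrow> real" and w :: "'q \<Rightarrow> real"
  assumes "finite T" and "finite Q" and "\<And>q. q \<in> Q \<Longrightarrow> w q \<ge> 0"
  shows "\<exists>\<epsilon>. (\<forall>t. \<epsilon> t = 1 \<or> \<epsilon> t = - 1) \<and>
    (\<Sum>q\<in>Q. w q * exp (\<Sum>t\<in>T. \<epsilon> t * c q t)) \<le> (\<Sum>q\<in>Q. w q * exp (\<Sum>t\<in>T. (c q t)\<^sup>2))"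
  using assms(1,3)
proof (induction T arbitrary: w rule: finite_induct)
  case empty
  show ?case by (intro exI[of _ "\<lambda>_. 1"]) auto
next
  case (insert s T)
  \<comment> \<open>The weights handed to the induction hypothesis already carry the factor
    \<open>exp ((c q s)^2)\<close>, the price of averaging over the sign at
    \<open>s\<close>.\<close>
  obtain \<epsilon> :: "'t \<Rightarrow> real" where \<epsilon>: "\<forall>t. \<epsilon> t = 1 \<or> \<epsilon> t = - 1"
    "(\<Sum>q\<in>Q. (w q * exp ((c q s)\<^sup>2)) * exp (\<Sum>t\<in>T. \<epsilon> t * c q t))
      \<le> (\<Sum>q\<in>Q. (w q * exp ((c q s)\<^sup>2)) * exp (\<Sum>t\<in>T. (c q t)\<^sup>2))"
    using insert.IH[of "\<lambda>q. w q * exp ((c q s)\<^sup>2)"] insert.prems by auto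
  define F where "F \<sigma> = (\<Sum>q\<in>Q. w q * exp (\<Sum>t\<in>T. \<epsilon> t * c q t) * exp (\<sigma> * c q s))" for \<sigma> :: real
  have "F 1 + F (- 1) = (\<Sum>q\<in>Q. w q * exp (\<Sum>t\<in>T. \<epsilon> t * c q t) * (exp (c q s) + exp (- c q s)))"
    by (simp add: F_def sum.distrib distrib_left)
  also have "\<dots> \<le> (\<Sum>q\<in>Q. w q * exp (\<Sum>t\<in>T. \<epsilon> t * c q t) * (2 * exp ((c q s)\<^sup>2)))"
    using insert.prems by (intro sum_mono mult_left_mono exp_add_exp_minus_le) auto
  also have "\<dots> = 2 * (\<Sum>q\<in>Q. (w q * exp ((c q s)\<^sup>2)) * exp (\<Sum>t\<in>T. \<epsilon> t * c q t))"
    by (simp add: sum_distrib_left mult_ac)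
  finally have sum_le: "F 1 + F (- 1) \<le> 2 * (\<Sum>q\<in>Q. (w q * exp ((c q s)\<^sup>2)) * exp (\<Sum>t\<in>T. \<epsilon> t * c q t))" .
  define \<sigma> :: real where "\<sigma> = (if F 1 \<le> F (- 1) then 1 else - 1)"
  have \<sigma>: "\<sigma> = 1 \<or> \<sigma> = - 1" "F \<sigma> \<le> (\<Sum>q\<in>Q. (w q * exp ((c q s)\<^sup>2)) * exp (\<Sum>t\<in>T. \<epsilon> t * c q t))"
    using sum_le by (auto simp: \<sigma>_def)
  have upd: "(\<Sum>t\<in>insert s T. (\<epsilon>(s := \<sigma>)) t * c q t) = \<sigma> * c q s + (\<Sum>t\<in>T. \<epsilon> t * c q t)" for q
  proof -
    have "(\<Sum>t\<in>T. (\<epsilon>(s := \<sigma>)) t * c q t) = (\<Sum>t\<in>T. \<epsilon> t * c q t)"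
      using insert.hyps by (intro sum.cong) auto
    then show ?thesis
      using insert.hyps by simp
  qed
  have "(\<Sum>q\<in>Q. w q * exp (\<Sum>t\<in>insert s T. (\<epsilon>(s := \<sigma>)) t * c q t)) = F \<sigma>"
    unfolding F_def upd exp_add by (intro sum.cong) auto
  also have "\<dots> \<le> (\<Sum>q\<in>Q. (w q * exp ((c q s)\<^sup>2)) * exp (\<Sum>t\<in>T. (c q t)\<^sup>2))"
    using \<sigma>(2) \<epsilon>(2) by linarith
  also have "\<dots> = (\<Sum>q\<in>Q. w q * exp (\<Sum>t\<in>insert s T. (c q t)\<^sup>2))"
    using insert.hyps by (intro sum.cong) (auto simp: exp_add mult_ac)
  finally show ?case
    using \<epsilon>(1) \<sigma>(1) by (intro exI[of _ "\<epsilon>(s := \<sigma>)"]) auto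
qed

section \<open>Counting integer points in a ball\<close>

lemma sum_half_power_nat_abs:
  "(\<Sum>j\<in>{- int R..int R}. (1 / 2 :: real) ^ nat \<bar>j\<bar>) = 3 - 2 * (1 / 2) ^ R"
proof (induction R)
  case (Suc R)
  have "{- int (Suc R)..int (Suc R)} = insert (- int (Suc R)) (insert (int (Suc R)) {- int R..int R})"
    by auto
  then show ?case
    using Suc by (simp add: nat_add_distrib)
qed simp

lemma abs_le_square_int: "\<bar>j\<bar> \<le> (j :: int)\<^sup>2"
proof (cases "j = 0")
  case False
  then have "\<bar>j\<bar> * 1 \<le> \<bar>j\<bar> * \<bar>j\<bar>"
    by (intro mult_left_mono) auto
  then show ?thesis
    by (simp add: power2_eq_square)
qed simp

text \<open>\<open>M\<close> is the squared radius. Extensionality outside \<open>S\<close> makes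
  the set finite for finite \<open>S\<close>, so that its points can be counted.\<close>

definition int_ball :: "'s set \<Rightarrow> nat \<Rightarrow> ('s \<Rightarrow> int) set" where
  "int_ball S M = {z \<in> S \<rightarrow>\<^sub>E UNIV. (\<Sum>s\<in>S. (z s)\<^sup>2) \<le> int M}"

lemma int_ball_subset:
  assumes "finite S"
  shows "int_ball S M \<subseteq> S \<rightarrow>\<^sub>E {- int M..int M}"
proof
  fix z assume z: "z \<in> int_ball S M"
  have "z s \<in> {- int M..int M}" if "s \<in> S" for s
  proof -
    have "\<bar>z s\<bar> \<le> (z s)\<^sup>2"
      by (rule abs_le_square_int)
    also have "\<dots> \<le> (\<Sum>s\<in>S. (z s)\<^sup>2)"
      using assms that by (intro member_le_sum) auto
    also have "\<dots> \<le> int M"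
      using z by (simp add: int_ball_def)
    finally show ?thesis by auto
  qed
  then show "z \<in> S \<rightarrow>\<^sub>E {- int M..int M}"
    using z by (auto simp: int_ball_def PiE_iff)
qed

lemma finite_int_ball: "finite S \<Longrightarrow> finite (int_ball S M)"
  by (rule finite_subset[OF int_ball_subset]) (auto intro: finite_PiE)

text \<open>Each point of the ball has weight at least \<open>2^-M\<close> under the product weight
  \<open>z \<mapsto> \<Prod>s. 2^-\<bar>z s\<bar>\<close>, whose total mass is at most \<open>3^card S\<close>.\<close>

lemma card_int_ball_le:
  assumes S: "finite S"
  shows "real (card (int_ball S M)) \<le> 3 ^ card S * 2 ^ M"
proof -
  have "real (card (int_ball S M)) * (1 / 2) ^ M = (\<Sum>z\<in>int_ball S M. (1 / 2) ^ M)"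
    by simp
  also have "\<dots> \<le> (\<Sum>z\<in>int_ball S M. \<Prod>s\<in>S. (1 / 2) ^ nat \<bar>z s\<bar>)"
  proof (rule sum_mono)
    fix z assume z: "z \<in> int_ball S M"
    have "int (\<Sum>s\<in>S. nat \<bar>z s\<bar>) = (\<Sum>s\<in>S. \<bar>z s\<bar>)"
      by simp
    also have "\<dots> \<le> (\<Sum>s\<in>S. (z s)\<^sup>2)"
      by (intro sum_mono abs_le_square_int)
    also have "\<dots> \<le> int M"
      using z by (simp add: int_ball_def)
    finally have "(\<Sum>s\<in>S. nat \<bar>z s\<bar>) \<le> M"
      by (simp only: of_nat_le_iff)
    then have "(1 / 2 :: real) ^ M \<le> (1 / 2) ^ (\<Sum>s\<in>S. nat \<bar>z s\<bar>)"
      by (intro power_decreasing) auto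
    then show "(1 / 2 :: real) ^ M \<le> (\<Prod>s\<in>S. (1 / 2) ^ nat \<bar>z s\<bar>)"
      by (simp add: power_sum)
  qed
  \<comment> \<open>Enlarging the ball to a box turns the sum of products into a product of
    geometric sums, each at most \<open>3\<close>.\<close>
  also have "\<dots> \<le> (\<Sum>z\<in>S \<rightarrow>\<^sub>E {- int M..int M}. \<Prod>s\<in>S. (1 / 2) ^ nat \<bar>z s\<bar>)"
    using S int_ball_subset[OF S] by (intro sum_mono2) (auto intro: finite_PiE prod_nonneg)
  also have "\<dots> = (\<Prod>s\<in>S. \<Sum>j\<in>{- int M..int M}. (1 / 2) ^ nat \<bar>j\<bar>)"
    using S by (subst prod_sum_PiE) auto
  also have "\<dots> \<le> (\<Prod>s\<in>S. 3)"
  proof (rule prod_mono)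
    have "(1 / 2 :: real) ^ M \<le> 1"
      by (simp add: power_le_one)
    moreover have "0 \<le> (1 / 2 :: real) ^ M"
      by simp
    ultimately show "0 \<le> (\<Sum>j\<in>{- int M..int M}. (1 / 2 :: real) ^ nat \<bar>j\<bar>) \<and>
        (\<Sum>j\<in>{- int M..int M}. (1 / 2 :: real) ^ nat \<bar>j\<bar>) \<le> 3" for s
      unfolding sum_half_power_nat_abs by linarith
  qed
  finally show ?thesis
    by (simp add: power_one_over field_simps)
qed

section \<open>Rounding low-rank matrices\<close>

text \<open>Rounding \<open>t\<close> down with probability \<open>1 - \<theta>\<close> and up with
  probability \<open>\<theta>\<close> has mean \<open>t\<close> and variance
  \<open>\<theta> (1 - \<theta>) \<le> 1\<close>. The expected value of the concave quadratic thus
  drops by at most \<open>q\<close>, and one of the two neighbours does at least as well as the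
  average.\<close>

lemma round_one_coordinate:
  fixes \<alpha> \<beta> q t :: real
  assumes "q \<ge> 0"
  shows "\<exists>j :: int. \<bar>of_int j - t\<bar> \<le> 1 \<and>
    \<alpha> + \<beta> * of_int j - q * (of_int j)\<^sup>2 \<ge> \<alpha> + \<beta> * t - q * t\<^sup>2 - q"
proof -
  define f where "f = real_of_int \<lfloor>t\<rfloor>"
  define \<theta> where "\<theta> = t - f"
  have \<theta>: "0 \<le> \<theta>" "\<theta> \<le> 1"
    unfolding \<theta>_def f_def by linarith+
  define G where "G x = \<alpha> + \<beta> * x - q * x\<^sup>2" for x
  have "(1 - \<theta>) * G f + \<theta> * G (f + 1) = G t - q * (\<theta> * (1 - \<theta>))"
    unfolding G_def \<theta>_def by (simp add: power2_eq_square algebra_simps)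
  moreover have "q * (\<theta> * (1 - \<theta>)) \<le> q * 1"
    using \<theta> assms by (intro mult_left_mono) (auto intro: mult_le_one)
  ultimately have le: "(1 - \<theta>) * G f + \<theta> * G (f + 1) \<ge> (1 - \<theta>) * (G t - q) + \<theta> * (G t - q)"
    by (simp add: algebra_simps)
  have "G f \<ge> G t - q \<or> G (f + 1) \<ge> G t - q"
  proof (rule ccontr)
    assume "\<not> ?thesis"
    then have less: "G f < G t - q" "G (f + 1) < G t - q" by auto
    have "(1 - \<theta>) * G f + \<theta> * G (f + 1) < (1 - \<theta>) * (G t - q) + \<theta> * (G t - q)"
    proof (cases "\<theta> = 0")
      case False
      then show ?thesis
        using less \<theta> by (intro add_le_less_mono mult_left_mono mult_strict_left_mono) simp_all
    qed (use less in simp)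
    with le show False by linarith
  qed
  then show ?thesis
  proof
    assume "G f \<ge> G t - q"
    then show ?thesis
      using \<theta> by (intro exI[of _ "\<lfloor>t\<rfloor>"]) (auto simp: G_def f_def \<theta>_def)
  next
    assume "G (f + 1) \<ge> G t - q"
    then show ?thesis
      using \<theta> by (intro exI[of _ "\<lfloor>t\<rfloor> + 1"]) (auto simp: G_def f_def \<theta>_def)
  qed
qed

text \<open>A deterministic substitute for independent randomised rounding: the penalised functional is
  concave quadratic in each coordinate, so rounding one coordinate costs only its quadratic
  coefficient.\<close>

lemma round_penalised_functional:
  fixes x :: "'s \<Rightarrow> real" and h :: "'s \<Rightarrow> 'b \<Rightarrow> real" and g e :: "'b \<Rightarrow> real"
  assumes "finite S" "finite I" "\<mu> \<ge> 0"
  shows "\<exists>z :: 's \<Rightarrow> int. (\<forall>s\<in>S. \<bar>of_int (z s) - x s\<bar> \<le> 1) \<and>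
    (\<Sum>b\<in>I. g b * (e b + (\<Sum>s\<in>S. x s * h s b))) - \<mu> * (\<Sum>b\<in>I. (e b + (\<Sum>s\<in>S. x s * h s b))\<^sup>2)
      \<le> (\<Sum>b\<in>I. g b * (e b + (\<Sum>s\<in>S. of_int (z s) * h s b)))
         - \<mu> * (\<Sum>b\<in>I. (e b + (\<Sum>s\<in>S. of_int (z s) * h s b))\<^sup>2) + \<mu> * (\<Sum>s\<in>S. \<Sum>b\<in>I. (h s b)\<^sup>2)"
  using assms(1)
proof (induction S arbitrary: e rule: finite_induct)
  case empty
  show ?case by auto
next
  case (insert r S)
  define H where "H = (\<Sum>b\<in>I. (h r b)\<^sup>2)"
  define d where "d b = e b + (\<Sum>s\<in>S. x s * h s b)" for b
  define \<Psi> where "\<Psi> u = (\<Sum>b\<in>I. g b * u b) - \<mu> * (\<Sum>b\<in>I. (u b)\<^sup>2)" for u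
  have quad: "\<Psi> (\<lambda>b. d b + t * h r b) = \<Psi> d +
      ((\<Sum>b\<in>I. g b * h r b) - 2 * \<mu> * (\<Sum>b\<in>I. d b * h r b)) * t - (\<mu> * H) * t\<^sup>2" for t
    unfolding \<Psi>_def H_def
    by (simp add: sum.distrib sum_distrib_left sum_distrib_right algebra_simps power2_eq_square)
  have "\<mu> * H \<ge> 0"
    using assms(3) by (auto simp: H_def intro!: mult_nonneg_nonneg sum_nonneg)
  then obtain j :: int where j: "\<bar>of_int j - x r\<bar> \<le> 1"
    "\<Psi> (\<lambda>b. d b + x r * h r b) \<le> \<Psi> (\<lambda>b. d b + of_int j * h r b) + \<mu> * H"
    using round_one_coordinate[of "\<mu> * H" "x r" "\<Psi> d"
        "(\<Sum>b\<in>I. g b * h r b) - 2 * \<mu> * (\<Sum>b\<in>I. d b * h r b)"]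
    unfolding quad diff_le_eq by blast
  \<comment> \<open>The rounded contribution of \<open>r\<close> moves into the offset; this is why
    \<open>e\<close> is generalised in the induction.\<close>
  obtain z :: "'s \<Rightarrow> int" where z: "\<forall>s\<in>S. \<bar>of_int (z s) - x s\<bar> \<le> 1"
    "\<Psi> (\<lambda>b. (e b + of_int j * h r b) + (\<Sum>s\<in>S. x s * h s b))
      \<le> \<Psi> (\<lambda>b. (e b + of_int j * h r b) + (\<Sum>s\<in>S. of_int (z s) * h s b))
         + \<mu> * (\<Sum>s\<in>S. \<Sum>b\<in>I. (h s b)\<^sup>2)"
    using insert.IH[of "\<lambda>b. e b + of_int j * h r b"] unfolding \<Psi>_def by blast
  define z' where "z' = z(r := j)"
  have z': "(\<Sum>s\<in>insert r S. of_int (z' s) * h s b) = of_int j * h r b + (\<Sum>s\<in>S. of_int (z s) * h s b)" for b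
  proof -
    have "(\<Sum>s\<in>S. of_int (z' s) * h s b) = (\<Sum>s\<in>S. of_int (z s) * h s b)"
      unfolding z'_def using insert.hyps by (intro sum.cong) auto
    then show ?thesis
      using insert.hyps by (simp add: z'_def)
  qed
  have "\<Psi> (\<lambda>b. e b + (\<Sum>s\<in>insert r S. x s * h s b)) = \<Psi> (\<lambda>b. d b + x r * h r b)"
    using insert.hyps by (simp add: d_def add_ac)
  also have "\<dots> \<le> \<Psi> (\<lambda>b. (e b + of_int j * h r b) + (\<Sum>s\<in>S. x s * h s b)) + \<mu> * H"
    using j(2) by (simp add: d_def add_ac)
  also have "\<dots> \<le> \<Psi> (\<lambda>b. (e b + of_int j * h r b) + (\<Sum>s\<in>S. of_int (z s) * h s b))
         + \<mu> * (\<Sum>s\<in>insert r S. \<Sum>b\<in>I. (h s b)\<^sup>2)"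
    using z(2) insert.hyps by (simp add: H_def distrib_left)
  also have "(\<lambda>b. (e b + of_int j * h r b) + (\<Sum>s\<in>S. of_int (z s) * h s b))
     = (\<lambda>b. e b + (\<Sum>s\<in>insert r S. of_int (z' s) * h s b))"
    by (simp only: z' add_ac)
  finally have "\<Psi> (\<lambda>b. e b + (\<Sum>s\<in>insert r S. x s * h s b))
    \<le> \<Psi> (\<lambda>b. e b + (\<Sum>s\<in>insert r S. of_int (z' s) * h s b)) + \<mu> * (\<Sum>s\<in>insert r S. \<Sum>b\<in>I. (h s b)\<^sup>2)" .
  moreover have "\<forall>s\<in>insert r S. \<bar>of_int (z' s) - x s\<bar> \<le> 1"
    using z(1) j(1) by (auto simp: z'_def)
  ultimately show ?case
    unfolding \<Psi>_def by blast
qed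

text \<open>Gram-Schmidt on the second factors, the change of basis being absorbed in the first
  ones. Dependent vectors become zero vectors with zero coefficients instead of being dropped, so
  the number of terms stays \<open>r\<close>.\<close>

lemma exists_orthonormal_factorisation:
  fixes y v :: "nat \<Rightarrow> nat \<Rightarrow> real"
  shows "\<exists>y' e. (\<forall>i<r. \<forall>j<r. i \<noteq> j \<longrightarrow> (\<Sum>c<p. e i c * e j c) = 0) \<and>
    (\<forall>i<r. (\<Sum>c<p. (e i c)\<^sup>2) = 1 \<or> (\<forall>c<p. e i c = 0) \<and> (\<forall>a. y' i a = 0)) \<and>
    (\<forall>a. \<forall>c<p. (\<Sum>i<r. y i a * v i c) = (\<Sum>i<r. y' i a * e i c))"
proof (induction r)
  case (Suc r)
  then obtain y' e where factor: "(\<forall>i<r. \<forall>j<r. i \<noteq> j \<longrightarrow> (\<Sum>c<p. e i c * e j c) = 0) \<and>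
    (\<forall>i<r. (\<Sum>c<p. (e i c)\<^sup>2) = 1 \<or> (\<forall>c<p. e i c = 0) \<and> (\<forall>a. y' i a = 0)) \<and>
    (\<forall>a. \<forall>c<p. (\<Sum>i<r. y i a * v i c) = (\<Sum>i<r. y' i a * e i c))"
    by (elim exE)
  have orth: "\<And>i j. i < r \<Longrightarrow> j < r \<Longrightarrow> i \<noteq> j \<Longrightarrow> (\<Sum>c<p. e i c * e j c) = 0"
    and norm: "\<And>i. i < r \<Longrightarrow> (\<Sum>c<p. (e i c)\<^sup>2) = 1 \<or> (\<forall>c<p. e i c = 0) \<and> (\<forall>a. y' i a = 0)"
    and eq: "\<And>a c. c < p \<Longrightarrow> (\<Sum>i<r. y i a * v i c) = (\<Sum>i<r. y' i a * e i c)"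
    using factor by simp_all
  define t where "t j = (\<Sum>c<p. v r c * e j c)" for j
  define g where "g c = v r c - (\<Sum>j<r. t j * e j c)" for c
  have g_orth: "(\<Sum>c<p. g c * e i c) = 0" if i: "i < r" for i
  proof -
    have "(\<Sum>c<p. (\<Sum>j<r. t j * e j c) * e i c) = (\<Sum>j<r. t j * (\<Sum>c<p. e j c * e i c))"
      unfolding sum_distrib_left sum_distrib_right
      by (subst sum.swap) (simp add: mult_ac)
    also have "\<dots> = (\<Sum>j<r. if j = i then t i * (\<Sum>c<p. (e i c)\<^sup>2) else 0)"
      using orth i by (intro sum.cong) (auto simp: power2_eq_square)
    also have "\<dots> = t i * (\<Sum>c<p. (e i c)\<^sup>2)"
      using i by simp
    also have "\<dots> = t i"
      using norm[OF i] by (auto simp: t_def)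
    finally show ?thesis
      by (simp add: g_def left_diff_distrib sum_subtractf t_def)
  qed
  define \<rho> where "\<rho> = sqrt (\<Sum>c<p. (g c)\<^sup>2)"
  have \<rho>: "\<rho>\<^sup>2 = (\<Sum>c<p. (g c)\<^sup>2)"
    unfolding \<rho>_def by (simp add: sum_nonneg)
  \<comment> \<open>If \<open>\<rho> = 0\<close>, division by zero yields the zero vector and
    \<open>y''\<close> has coefficient \<open>0\<close> at \<open>r\<close>, which is exactly the
    second alternative of the norm condition.\<close>
  define e' where "e' = e(r := \<lambda>c. g c / \<rho>)"
  define y'' where "y'' = (\<lambda>i a. if i = r then \<rho> * y r a else y' i a + t i * y r a)"
  have g0: "g c = 0" if "\<rho> = 0" "c < p" for c
    using \<rho> that by (simp add: sum_nonneg_eq_0_iff)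
  have orth': "(\<Sum>c<p. e' i c * e' j c) = 0" if "i < Suc r" "j < Suc r" "i \<noteq> j" for i j
  proof -
    have *: "(\<Sum>c<p. g c / \<rho> * e i c) = 0" "(\<Sum>c<p. e i c * (g c / \<rho>)) = 0" if "i < r" for i
      using g_orth[OF that] by (simp_all flip: sum_divide_distrib add: mult.commute)
    show ?thesis
      using that * orth by (auto simp: e'_def less_Suc_eq)
  qed
  have norm': "(\<Sum>c<p. (e' i c)\<^sup>2) = 1 \<or> (\<forall>c<p. e' i c = 0) \<and> (\<forall>a. y'' i a = 0)"
    if "i < Suc r" for i
  proof (cases "i = r")
    case True
    show ?thesis
    proof (cases "\<rho> = 0")
      case False
      have "(\<Sum>c<p. (e' i c)\<^sup>2) = (\<Sum>c<p. (g c)\<^sup>2) / \<rho>\<^sup>2"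
        using True by (simp add: e'_def power_divide sum_divide_distrib)
      also have "\<dots> = 1"
        using False by (simp only: \<rho>[symmetric]) simp
      finally have "(\<Sum>c<p. (e' i c)\<^sup>2) = 1" .
      then show ?thesis ..
    qed (use True g0 in \<open>auto simp: e'_def y''_def\<close>)
  next
    case False
    then show ?thesis
      using that norm[of i] by (auto simp: e'_def y''_def t_def)
  qed
  have eq': "(\<Sum>i<Suc r. y i a * v i c) = (\<Sum>i<Suc r. y'' i a * e' i c)" if c: "c < p" for a c
  proof -
    have "(\<Sum>i<Suc r. y'' i a * e' i c) = (\<Sum>i<r. y' i a * e i c) + y r a * (\<Sum>i<r. t i * e i c) + y r a * g c"
      using g0[OF _ c] by (auto simp: y''_def e'_def sum.distrib sum_distrib_left algebra_simps)
    then show ?thesis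
      using eq[OF c] by (simp add: g_def algebra_simps)
  qed
  show ?case
    by (intro exI[of _ y''] exI[of _ e'] conjI allI impI orth' norm' eq')
qed simp

lemma sum_Times: "(\<Sum>b\<in>A \<times> B. f b) = (\<Sum>a\<in>A. \<Sum>c\<in>B. f (a, c))"
  by (simp add: sum.cartesian_product)

text \<open>Parseval for one row; a zero vector among the \<open>e i\<close> does no harm because
  its coefficient vanishes too.\<close>

lemma sum_square_orthonormal:
  fixes y e :: "nat \<Rightarrow> nat \<Rightarrow> real"
  assumes "\<And>i j. i < r \<Longrightarrow> j < r \<Longrightarrow> i \<noteq> j \<Longrightarrow> (\<Sum>c<p. e i c * e j c) = 0"
    and "\<And>i. i < r \<Longrightarrow> (\<Sum>c<p. (e i c)\<^sup>2) = 1 \<or> (\<forall>c<p. e i c = 0) \<and> (\<forall>a. y i a = 0)"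
  shows "(\<Sum>c<p. (\<Sum>i<r. y i a * e i c)\<^sup>2) = (\<Sum>i<r. (y i a)\<^sup>2)"
proof -
  have "(\<Sum>c<p. (\<Sum>i<r. y i a * e i c)\<^sup>2) = (\<Sum>c<p. \<Sum>i<r. \<Sum>j<r. y i a * y j a * (e i c * e j c))"
    by (simp add: power2_eq_square sum_product mult_ac)
  also have "\<dots> = (\<Sum>i<r. \<Sum>c<p. \<Sum>j<r. y i a * y j a * (e i c * e j c))"
    by (rule sum.swap)
  also have "\<dots> = (\<Sum>i<r. \<Sum>j<r. y i a * y j a * (\<Sum>c<p. e i c * e j c))"
    unfolding sum_distrib_left by (intro sum.cong refl sum.swap)
  also have "\<dots> = (\<Sum>i<r. \<Sum>j<r. if j = i then (y i a)\<^sup>2 else 0)"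
  proof (intro sum.cong refl)
    fix i j assume "i \<in> {..<r}" "j \<in> {..<r}"
    then show "y i a * y j a * (\<Sum>c<p. e i c * e j c) = (if j = i then (y i a)\<^sup>2 else 0)"
      using assms(1)[of i j] assms(2)[of i] by (auto simp: power2_eq_square)
  qed
  finally show ?thesis by simp
qed

text \<open>The first factor is rounded to multiples of \<open>1 / \<surd>(p r)\<close>, the second one to multiples of \<open>1 / \<surd>p\<close>.\<close>

definition lattice_mat :: "nat \<Rightarrow> nat \<Rightarrow> (nat \<times> nat \<Rightarrow> int) \<Rightarrow> (nat \<times> nat \<Rightarrow> int) \<Rightarrow> nat \<times> nat \<Rightarrow> real" where
  "lattice_mat p r Y Z = (\<lambda>(a, c). (\<Sum>i<r. of_int (Y (i, a)) * of_int (Z (i, c))) / (real p * sqrt (real r)))"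

text \<open>With \<open>d\<close> the rounding error,
  \<open>(x + d)^2 \<le> 2 x^2 + 2 d^2 \<le> 2 x^2 + 2\<close>. Summing over \<open>S\<close> gives
  \<open>2 card S + 2 card S\<close>, the origin of the factor \<open>4\<close>.\<close>

lemma restrict_in_int_ball:
  fixes x :: "'s \<Rightarrow> real" and z :: "'s \<Rightarrow> int"
  assumes close: "\<And>s. s \<in> S \<Longrightarrow> \<bar>of_int (z s) - x s\<bar> \<le> 1"
    and x: "(\<Sum>s\<in>S. (x s)\<^sup>2) \<le> real (card S)"
  shows "restrict z S \<in> int_ball S (4 * card S)"
proof -
  have "real_of_int (\<Sum>s\<in>S. (z s)\<^sup>2) \<le> (\<Sum>s\<in>S. 2 * (x s)\<^sup>2 + 2)"
    unfolding of_int_sum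
  proof (rule sum_mono)
    fix s assume "s \<in> S"
    define d where "d = of_int (z s) - x s"
    have "d\<^sup>2 \<le> 1"
      using close[OF \<open>s \<in> S\<close>] by (simp add: d_def abs_square_le_1)
    moreover have "0 \<le> (d - x s)\<^sup>2"
      by simp
    moreover have "real_of_int (z s) = x s + d"
      by (simp add: d_def)
    ultimately show "real_of_int ((z s)\<^sup>2) \<le> 2 * (x s)\<^sup>2 + 2"
      by (simp add: power2_eq_square algebra_simps)
  qed
  also have "\<dots> \<le> 4 * real (card S)"
    using x by (simp add: sum.distrib flip: sum_distrib_left)
  finally have "(\<Sum>s\<in>S. (z s)\<^sup>2) \<le> int (4 * card S)"
    by linarith
  then show ?thesis
    by (simp add: int_ball_def)
qed

text \<open>Making the second factors orthonormal bounds the squared norms of the factors by \<open>1\<close> and \<open>r\<close>;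
  this is what keeps the cost of both roundings at \<open>O(\<mu>)\<close>, independently of \<open>p\<close> and \<open>r\<close>.\<close>

lemma low_rank_rounding:
  fixes y v :: "nat \<Rightarrow> nat \<Rightarrow> real" and g :: "nat \<times> nat \<Rightarrow> real"
  assumes "p \<ge> 1" "r \<ge> 1" "\<mu> \<ge> 0"
  defines "u \<equiv> \<lambda>(a, c). \<Sum>i<r. y i a * v i c"
  assumes unit: "(\<Sum>b\<in>{..<p} \<times> {..<p}. (u b)\<^sup>2) = 1"
  obtains Y Z where "Y \<in> int_ball ({..<r} \<times> {..<p}) (4 * (r * p))"
    and "Z \<in> int_ball ({..<r} \<times> {..<p}) (4 * (r * p))"
    and "(\<Sum>b\<in>{..<p} \<times> {..<p}. g b * u b) \<le> (\<Sum>b\<in>{..<p} \<times> {..<p}. g b * lattice_mat p r Y Z b)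
      - \<mu> * (\<Sum>b\<in>{..<p} \<times> {..<p}. (lattice_mat p r Y Z b)\<^sup>2) + 6 * \<mu>"
proof -
  define S where "S = {..<r} \<times> {..<p}"
  define I where "I = {..<p} \<times> {..<p}"
  have fin: "finite S" "finite I" and card_S: "card S = r * p"
    by (auto simp: S_def I_def)
  define \<Psi> where "\<Psi> f = (\<Sum>b\<in>I. g b * f b) - \<mu> * (\<Sum>b\<in>I. (f b)\<^sup>2)" for f
  have \<Psi>_cong: "\<Psi> f = \<Psi> f'" if "\<And>b. b \<in> I \<Longrightarrow> f b = f' b" for f f'
    unfolding \<Psi>_def using that by auto
  obtain y' e where factor: "(\<forall>i<r. \<forall>j<r. i \<noteq> j \<longrightarrow> (\<Sum>c<p. e i c * e j c) = 0) \<and>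
    (\<forall>i<r. (\<Sum>c<p. (e i c)\<^sup>2) = 1 \<or> (\<forall>c<p. e i c = 0) \<and> (\<forall>a. y' i a = 0)) \<and>
    (\<forall>a. \<forall>c<p. (\<Sum>i<r. y i a * v i c) = (\<Sum>i<r. y' i a * e i c))"
    using exists_orthonormal_factorisation[of r p y v] by (elim exE)
  have orth: "\<And>i j. i < r \<Longrightarrow> j < r \<Longrightarrow> i \<noteq> j \<Longrightarrow> (\<Sum>c<p. e i c * e j c) = 0"
    and norm: "\<And>i. i < r \<Longrightarrow> (\<Sum>c<p. (e i c)\<^sup>2) = 1 \<or> (\<forall>c<p. e i c = 0) \<and> (\<forall>a. y' i a = 0)"
    and eq: "\<And>a c. c < p \<Longrightarrow> (\<Sum>i<r. y i a * v i c) = (\<Sum>i<r. y' i a * e i c)"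
    using factor by simp_all
  have y'_norm: "(\<Sum>i<r. \<Sum>a<p. (y' i a)\<^sup>2) = 1"
  proof -
    have "1 = (\<Sum>a<p. \<Sum>c<p. (\<Sum>i<r. y' i a * e i c)\<^sup>2)"
      using unit by (simp add: u_def eq sum_Times)
    also have "\<dots> = (\<Sum>a<p. \<Sum>i<r. (y' i a)\<^sup>2)"
      using sum_square_orthonormal[OF orth norm] by simp
    finally show ?thesis
      by (subst sum.swap) simp
  qed
  \<comment> \<open>First pass: the orthonormal factor. Scaled by \<open>sqrt p\<close> it has
    squared norm at most \<open>r p = card S\<close>, and the directions \<open>h\<close> have total
    squared norm \<open>1\<close>, so this pass costs \<open>\<mu>\<close>.\<close>
  define x where "x = (\<lambda>(i, c). sqrt (real p) * e i c)"
  define h where "h = (\<lambda>(i, c :: nat) (a, c'). if c = c' then y' i a / sqrt (real p) else 0)"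
  obtain z :: "nat \<times> nat \<Rightarrow> int" where z: "\<forall>s\<in>S. \<bar>of_int (z s) - x s\<bar> \<le> 1"
    "\<Psi> (\<lambda>b. \<Sum>s\<in>S. x s * h s b) \<le> \<Psi> (\<lambda>b. \<Sum>s\<in>S. of_int (z s) * h s b) + \<mu> * (\<Sum>s\<in>S. \<Sum>b\<in>I. (h s b)\<^sup>2)"
    using round_penalised_functional[OF fin assms(3), of x g "\<lambda>_. 0" h] unfolding \<Psi>_def by auto
  define Z where "Z = restrict z S"
  have sum_h: "(\<Sum>s\<in>S. f s * h s (a, c)) = (\<Sum>i<r. f (i, c) * y' i a) / sqrt (real p)" if "c < p" for f a c
    using that by (simp add: S_def h_def sum_Times if_distrib[of "(*) _"] sum_divide_distrib cong: if_cong)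
  have "(\<Sum>s\<in>S. (x s)\<^sup>2) = real p * (\<Sum>i<r. \<Sum>c<p. (e i c)\<^sup>2)"
    by (simp add: S_def x_def sum_Times power_mult_distrib sum_distrib_left)
  also have "\<dots> \<le> real p * (\<Sum>i<r. 1)"
    using norm by (intro mult_left_mono sum_mono) force+
  finally have Z: "Z \<in> int_ball S (4 * card S)"
    unfolding Z_def using z(1) by (intro restrict_in_int_ball) (auto simp: card_S mult.commute)
  have "(\<Sum>s\<in>S. \<Sum>b\<in>I. (h s b)\<^sup>2) = (\<Sum>i<r. \<Sum>c<p. \<Sum>a<p. (y' i a)\<^sup>2 / real p)"
    by (simp add: S_def I_def h_def sum_Times if_distrib[of "\<lambda>t. t ^ 2"] power_divide cong: if_cong)
  also have "\<dots> = (\<Sum>i<r. \<Sum>a<p. (y' i a)\<^sup>2)"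
    using assms(1) by (simp flip: sum_divide_distrib)
  finally have h_norm: "(\<Sum>s\<in>S. \<Sum>b\<in>I. (h s b)\<^sup>2) = 1"
    using y'_norm by simp
  \<comment> \<open>Second pass: the other factor, with \<open>Z\<close> already fixed. Its squared
    norm \<open>1\<close> is scaled up to \<open>r p\<close>; the directions \<open>h'\<close> have
    total squared norm \<open>(\<Sum>s\<in>S. (Z s)^2) / (p r) \<le> 4\<close>, so this pass costs
    \<open>4 \<mu>\<close>.\<close>
  define x' where "x' = (\<lambda>(i, a). sqrt (real r * real p) * y' i a)"
  define h' where "h' = (\<lambda>(i, a :: nat) (a', c). if a = a' then real_of_int (Z (i, c)) / (real p * sqrt (real r)) else 0)"
  obtain z' :: "nat \<times> nat \<Rightarrow> int" where z': "\<forall>s\<in>S. \<bar>of_int (z' s) - x' s\<bar> \<le> 1"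
    "\<Psi> (\<lambda>b. \<Sum>s\<in>S. x' s * h' s b) \<le> \<Psi> (\<lambda>b. \<Sum>s\<in>S. of_int (z' s) * h' s b) + \<mu> * (\<Sum>s\<in>S. \<Sum>b\<in>I. (h' s b)\<^sup>2)"
    using round_penalised_functional[OF fin assms(3), of x' g "\<lambda>_. 0" h'] unfolding \<Psi>_def by auto
  define Y where "Y = restrict z' S"
  have "(\<Sum>s\<in>S. (x' s)\<^sup>2) = real (card S) * (\<Sum>i<r. \<Sum>a<p. (y' i a)\<^sup>2)"
    by (simp add: S_def x'_def sum_Times power_mult_distrib sum_distrib_left)
  then have Y: "Y \<in> int_ball S (4 * card S)"
    unfolding Y_def using z'(1) y'_norm by (intro restrict_in_int_ball) auto
  have sum_h': "(\<Sum>s\<in>S. f s * h' s (a, c)) = (\<Sum>i<r. f (i, a) * of_int (Z (i, c))) / (real p * sqrt (real r))"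
    if "a < p" for f a c
    using that by (simp add: S_def h'_def sum_Times if_distrib[of "(*) _"] sum_divide_distrib cong: if_cong)
  have "(\<Sum>s\<in>S. \<Sum>b\<in>I. (h' s b)\<^sup>2) = (\<Sum>i<r. \<Sum>a<p. \<Sum>c<p. (of_int (Z (i, c)))\<^sup>2 / (real p * sqrt (real r))\<^sup>2)"
  proof -
    have "(\<Sum>b\<in>I. (h' (i, a) b)\<^sup>2) = (\<Sum>c<p. (of_int (Z (i, c)))\<^sup>2 / (real p * sqrt (real r))\<^sup>2)" if "a < p" for i a
    proof -
      have "(\<Sum>b\<in>I. (h' (i, a) b)\<^sup>2) = (\<Sum>a'<p. if a = a' then \<Sum>c<p. (of_int (Z (i, c)))\<^sup>2 / (real p * sqrt (real r))\<^sup>2 else 0)"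
        unfolding I_def sum_Times by (intro sum.cong) (auto simp: h'_def power_divide)
      then show ?thesis using that by simp
    qed
    then show ?thesis
      by (simp add: S_def sum_Times)
  qed
  also have "\<dots> = (\<Sum>s\<in>S. (of_int (Z s))\<^sup>2) / (real p * real r)"
    using assms(1) by (simp add: S_def sum_Times power_mult_distrib power2_eq_square flip: sum_divide_distrib)
  also have "\<dots> \<le> 4"
  proof -
    have "real_of_int (\<Sum>s\<in>S. (Z s)\<^sup>2) \<le> real_of_int (int (4 * card S))"
      using Z unfolding int_ball_def by (subst of_int_le_iff) simp
    then have "(\<Sum>s\<in>S. (real_of_int (Z s))\<^sup>2) \<le> 4 * (real p * real r)"
      by (simp add: card_S mult_ac)
    then show ?thesis
      using assms(1,2) by (simp add: divide_le_eq)
  qed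
  finally have h'_norm: "(\<Sum>s\<in>S. \<Sum>b\<in>I. (h' s b)\<^sup>2) \<le> 4" .
  have "\<Psi> u = \<Psi> (\<lambda>b. \<Sum>s\<in>S. x s * h s b)"
  proof (rule \<Psi>_cong)
    fix b assume "b \<in> I"
    then obtain a c where b: "b = (a, c)" "a < p" "c < p"
      by (auto simp: I_def)
    have "(\<Sum>s\<in>S. x s * h s b) = (\<Sum>i<r. x (i, c) * y' i a) / sqrt (real p)"
      unfolding b(1) by (rule sum_h[OF b(3)])
    also have "\<dots> = (\<Sum>i<r. y' i a * e i c)"
      using assms(1) by (simp add: x_def sum_divide_distrib mult_ac)
    finally show "u b = (\<Sum>s\<in>S. x s * h s b)"
      using b(3) by (simp add: b(1) u_def eq)
  qed
  also have "\<dots> \<le> \<Psi> (\<lambda>b. \<Sum>s\<in>S. of_int (z s) * h s b) + \<mu>"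
    using z(2) h_norm by simp
  also have "\<Psi> (\<lambda>b. \<Sum>s\<in>S. of_int (z s) * h s b) = \<Psi> (\<lambda>b. \<Sum>s\<in>S. x' s * h' s b)"
  proof (rule \<Psi>_cong)
    fix b assume "b \<in> I"
    then obtain a c where b: "b = (a, c)" "a < p" "c < p"
      by (auto simp: I_def)
    have "(\<Sum>s\<in>S. x' s * h' s b) = (\<Sum>i<r. of_int (z (i, c)) * y' i a / sqrt (real p))"
      unfolding b sum_h'[OF b(2)] sum_divide_distrib
      using b assms(1,2) by (intro sum.cong) (auto simp: Z_def S_def x'_def real_sqrt_mult field_simps)
    then show "(\<Sum>s\<in>S. of_int (z s) * h s b) = (\<Sum>s\<in>S. x' s * h' s b)"
      by (simp add: b sum_h sum_divide_distrib)
  qed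
  also have "\<dots> \<le> \<Psi> (\<lambda>b. \<Sum>s\<in>S. of_int (z' s) * h' s b) + \<mu> * 4"
    using z'(2) mult_left_mono[OF h'_norm assms(3)] by linarith
  also have "\<Psi> (\<lambda>b. \<Sum>s\<in>S. of_int (z' s) * h' s b) = \<Psi> (lattice_mat p r Y Z)"
  proof (rule \<Psi>_cong)
    fix b assume "b \<in> I"
    then obtain a c where b: "b = (a, c)" "a < p" "c < p"
      by (auto simp: I_def)
    show "(\<Sum>s\<in>S. of_int (z' s) * h' s b) = lattice_mat p r Y Z b"
      unfolding b(1) sum_h'[OF b(2)] using b by (simp add: lattice_mat_def Y_def S_def)
  qed
  finally have "\<Psi> u \<le> \<Psi> (lattice_mat p r Y Z) + 5 * \<mu>"
    by simp
  \<comment> \<open>The sixth \<open>\<mu>\<close> is the penalty of \<open>u\<close> itself, whose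
    norm is \<open>1\<close>.\<close>
  then have "(\<Sum>b\<in>I. g b * u b) \<le> (\<Sum>b\<in>I. g b * lattice_mat p r Y Z b)
      - \<mu> * (\<Sum>b\<in>I. (lattice_mat p r Y Z b)\<^sup>2) + 6 * \<mu>"
    using unit by (simp add: \<Psi>_def I_def)
  with Y Z show ?thesis
    unfolding card_S unfolding S_def I_def by (intro that)
qed

section \<open>Sign tensors that are small on low-rank matrices\<close>

definition sign_form :: "nat \<Rightarrow> ((nat \<times> nat) \<times> (nat \<times> nat) \<Rightarrow> real) \<Rightarrow> (nat \<times> nat \<Rightarrow> real) \<Rightarrow> (nat \<times> nat \<Rightarrow> real) \<Rightarrow> real" where
  "sign_form p \<epsilon> u w = (\<Sum>b\<in>{..<p} \<times> {..<p}. \<Sum>b'\<in>{..<p} \<times> {..<p}. \<epsilon> (b, b') * u b * w b')"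

text \<open>The left side is the bound of \<open>card_int_ball_le\<close> for \<open>N\<close>
  coordinates and squared radius \<open>4 N\<close>; it equals \<open>48^N\<close>, and
  \<open>48 < 2^6 \<le> exp 6\<close>.\<close>

lemma exp_6_bound: "(3 :: real) ^ N * 2 ^ (4 * N) \<le> exp (6 * real N)"
proof -
  have "(2 :: real) \<le> exp 1"
    using exp_ge_add_one_self[of 1] by simp
  then have "(2 :: real) ^ 6 \<le> exp 1 ^ 6"
    by (intro power_mono) auto
  also have "\<dots> = exp 6"
    by (simp flip: exp_of_nat_mult)
  finally have "(48 :: real) \<le> exp 6"
    by simp
  then have "(48 :: real) ^ N \<le> exp 6 ^ N"
    by (intro power_mono) auto
  then show ?thesis
    by (simp add: power_mult flip: exp_of_nat_mult power_mult_distrib) (simp add: mult.commute)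
qed

text \<open>Only finitely many inequalities, hence within reach of a union bound. They are stated
  homogeneously since lattice matrices have no prescribed norm.\<close>

definition lattice_bounded :: "nat \<Rightarrow> nat \<Rightarrow> ((nat \<times> nat) \<times> (nat \<times> nat) \<Rightarrow> real) \<Rightarrow> bool" where
  "lattice_bounded p r \<epsilon> \<longleftrightarrow>
    (\<forall>Y\<in>int_ball ({..<r} \<times> {..<p}) (4 * (r * p)). \<forall>Z\<in>int_ball ({..<r} \<times> {..<p}) (4 * (r * p)).
     \<forall>Y'\<in>int_ball ({..<r} \<times> {..<p}) (4 * (r * p)). \<forall>Z'\<in>int_ball ({..<r} \<times> {..<p}) (4 * (r * p)).
      sign_form p \<epsilon> (lattice_mat p r Y Z) (lattice_mat p r Y' Z') \<le> 10 * sqrt (real (r * p)) *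
        L2_set (lattice_mat p r Y Z) ({..<p} \<times> {..<p}) * L2_set (lattice_mat p r Y' Z') ({..<p} \<times> {..<p}))"

text \<open>With \<open>N = r p\<close>, each of the four lattice points has at most \<open>exp (6 N)\<close> values, and normalised
  coefficients scaled by \<open>5 \<surd>N\<close> have moment bound \<open>exp (25 N)\<close>; the weight \<open>exp (- 49 N)\<close> beats both.\<close>

lemma exists_signs_lattice_mat:
  assumes "p \<ge> 1" "finite R" "card R \<le> 2" "\<And>r. r \<in> R \<Longrightarrow> r \<ge> 1"
  shows "\<exists>\<epsilon>. (\<forall>t. \<epsilon> t = 1 \<or> \<epsilon> t = - 1) \<and>
    (\<forall>r\<in>R. lattice_bounded p r \<epsilon>)"
proof -
  define I where "I = {..<p} \<times> {..<p}"
  define D where "D r = int_ball ({..<r} \<times> {..<p}) (4 * (r * p))" for r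
  \<comment> \<open>Both ranks enter one union bound, since the same signs have to serve every
    \<open>r\<close> in \<open>R\<close>.\<close>
  define Q where "Q = (SIGMA r:R. D r \<times> D r \<times> D r \<times> D r)"
  \<comment> \<open>The coefficients of the signs in the form at two normalised matrices. For a zero
    matrix the division makes them all \<open>0\<close>, which still satisfies the moment bound;
    that case is treated separately at the end.\<close>
  define c where "c = (\<lambda>(r, Y, Z, Y', Z') (b, b').
    5 * sqrt (real (r * p)) * (lattice_mat p r Y Z b / L2_set (lattice_mat p r Y Z) I) *
      (lattice_mat p r Y' Z' b' / L2_set (lattice_mat p r Y' Z') I))"
  define \<omega> where "\<omega> = (\<lambda>q :: nat \<times> (nat \<times> nat \<Rightarrow> int) \<times> (nat \<times> nat \<Rightarrow> int) \<times> (nat \<times> nat \<Rightarrow> int) \<times> (nat \<times> nat \<Rightarrow> int).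
    exp (- (49 * real (fst q * p))))"
  have finD: "finite (D r)" for r
    by (simp add: D_def finite_int_ball)
  have finQ: "finite Q"
    using finD assms(2) by (auto simp: Q_def)
  have cardD: "real (card (D r)) \<le> exp (6 * real (r * p))" for r
    using card_int_ball_le[of "{..<r} \<times> {..<p}" "4 * (r * p)"] exp_6_bound[of "r * p"]
    by (simp add: D_def card_cartesian_product)
  obtain \<epsilon> :: "(nat \<times> nat) \<times> (nat \<times> nat) \<Rightarrow> real" where signs: "\<forall>t. \<epsilon> t = 1 \<or> \<epsilon> t = - 1"
    and moment: "(\<Sum>q\<in>Q. \<omega> q * exp (\<Sum>t\<in>I \<times> I. \<epsilon> t * c q t)) \<le> (\<Sum>q\<in>Q. \<omega> q * exp (\<Sum>t\<in>I \<times> I. (c q t)\<^sup>2))"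
    using exists_signs_exp_moment_le[of "I \<times> I" Q \<omega> c] finQ by (auto simp: \<omega>_def I_def)
  have unit: "(\<Sum>b\<in>I. (f b / L2_set f I)\<^sup>2) \<le> 1" for f :: "nat \<times> nat \<Rightarrow> real"
  proof -
    have "(\<Sum>b\<in>I. (f b / L2_set f I)\<^sup>2) = (\<Sum>b\<in>I. (f b)\<^sup>2) / (L2_set f I)\<^sup>2"
      by (simp add: power_divide sum_divide_distrib)
    also have "(L2_set f I)\<^sup>2 = (\<Sum>b\<in>I. (f b)\<^sup>2)"
      by (simp add: L2_set_def sum_nonneg)
    finally show ?thesis
      by (simp add: divide_le_eq_1)
  qed
  have c_le: "(\<Sum>t\<in>I \<times> I. (c q t)\<^sup>2) \<le> 25 * real (fst q * p)" for q
  proof -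
    obtain r Y Z Y' Z' where q: "q = (r, Y, Z, Y', Z')"
      by (cases q)
    define f where "f b = (lattice_mat p r Y Z b / L2_set (lattice_mat p r Y Z) I)" for b
    define f' where "f' b = (lattice_mat p r Y' Z' b / L2_set (lattice_mat p r Y' Z') I)" for b
    have "(\<Sum>t\<in>I \<times> I. (c q t)\<^sup>2) = (\<Sum>b\<in>I. \<Sum>b'\<in>I. 25 * real (r * p) * ((f b)\<^sup>2 * (f' b')\<^sup>2))"
    proof -
      have "c q (b, b') = 5 * sqrt (real (r * p)) * f b * f' b'" for b b'
        by (simp add: q c_def f_def f'_def)
      then show ?thesis
        unfolding sum_Times by (simp add: power_mult_distrib mult_ac)
    qed
    also have "\<dots> = 25 * real (r * p) * ((\<Sum>b\<in>I. (f b)\<^sup>2) * (\<Sum>b'\<in>I. (f' b')\<^sup>2))"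
      unfolding sum_product by (simp add: sum_distrib_left)
    also have "\<dots> \<le> 25 * real (r * p) * 1"
      using unit unfolding f_def f'_def
      by (intro mult_left_mono mult_le_one) (auto intro: sum_nonneg)
    finally show ?thesis by (simp add: q)
  qed
  have "(\<Sum>q\<in>Q. \<omega> q * exp (\<Sum>t\<in>I \<times> I. (c q t)\<^sup>2)) \<le> (\<Sum>q\<in>Q. exp (- (24 * real (fst q * p))))"
  proof (rule sum_mono)
    fix q
    have "\<omega> q * exp (\<Sum>t\<in>I \<times> I. (c q t)\<^sup>2) \<le> \<omega> q * exp (25 * real (fst q * p))"
      using c_le by (intro mult_left_mono) (auto simp: \<omega>_def)
    also have "\<dots> = exp (- (24 * real (fst q * p)))"
      by (simp add: \<omega>_def flip: exp_add)
    finally show "\<omega> q * exp (\<Sum>t\<in>I \<times> I. (c q t)\<^sup>2) \<le> exp (- (24 * real (fst q * p)))" .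
  qed
  also have "\<dots> = (\<Sum>r\<in>R. real (card (D r)) ^ 4 * exp (- (24 * real (r * p))))"
  proof -
    have "(\<Sum>q\<in>Q. exp (- (24 * real (fst q * p)))) =
        (\<Sum>r\<in>R. \<Sum>y\<in>D r \<times> D r \<times> D r \<times> D r. exp (- (24 * real (r * p))))"
      unfolding Q_def using finD assms(2) by (subst sum.Sigma) (auto simp: case_prod_unfold)
    then show ?thesis
      by (simp add: card_cartesian_product power4_eq_xxxx mult_ac)
  qed
  also have "\<dots> \<le> (\<Sum>r\<in>R. 1)"
  proof (rule sum_mono)
    fix r
    have "real (card (D r)) ^ 4 * exp (- (24 * real (r * p))) \<le> exp (6 * real (r * p)) ^ 4 * exp (- (24 * real (r * p)))"
      using cardD by (intro mult_right_mono power_mono) auto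
    also have "\<dots> = 1"
      by (simp flip: exp_of_nat_mult exp_add)
    finally show "real (card (D r)) ^ 4 * exp (- (24 * real (r * p))) \<le> 1" .
  qed
  also have "\<dots> \<le> 2"
    using assms(3) by simp
  finally have total: "(\<Sum>q\<in>Q. \<omega> q * exp (\<Sum>t\<in>I \<times> I. \<epsilon> t * c q t)) \<le> 2"
    using moment by linarith
  have bound: "sign_form p \<epsilon> (lattice_mat p r Y Z) (lattice_mat p r Y' Z') \<le> 10 * sqrt (real (r * p)) *
        L2_set (lattice_mat p r Y Z) I * L2_set (lattice_mat p r Y' Z') I"
    if r: "r \<in> R" and mem: "Y \<in> D r" "Z \<in> D r" "Y' \<in> D r" "Z' \<in> D r" for r Y Z Y' Z'
  proof -
    define q where "q = (r, Y, Z, Y', Z')"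
    define U where "U = lattice_mat p r Y Z"
    define W where "W = lattice_mat p r Y' Z'"
    define N where "N = real (r * p)"
    have N: "N \<ge> 1"
      using assms(1) assms(4)[OF r] by (simp add: N_def flip: of_nat_mult)
    \<comment> \<open>A single nonnegative term is at most the whole sum, which is at most
      \<open>2 \<le> exp 1\<close>. So the exponent is at most \<open>49 N + 1 \<le> 50 N\<close>,
      and undoing the scaling by \<open>5 sqrt N\<close> leaves \<open>10 sqrt N\<close>.\<close>
    have "\<omega> q * exp (\<Sum>t\<in>I \<times> I. \<epsilon> t * c q t) \<le> (\<Sum>q\<in>Q. \<omega> q * exp (\<Sum>t\<in>I \<times> I. \<epsilon> t * c q t))"
      using finQ r mem by (intro member_le_sum) (auto simp: q_def Q_def \<omega>_def)
    also have "\<dots> \<le> exp 1"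
      using total exp_ge_add_one_self[of 1] by linarith
    finally have "exp ((\<Sum>t\<in>I \<times> I. \<epsilon> t * c q t) - 49 * N) \<le> exp 1"
      by (simp add: \<omega>_def q_def N_def exp_diff exp_minus field_simps)
    then have *: "(\<Sum>t\<in>I \<times> I. \<epsilon> t * c q t) \<le> 50 * N"
      using N by simp
    show ?thesis
    proof (cases "L2_set U I = 0 \<or> L2_set W I = 0")
      case True
      then have "(\<forall>b\<in>I. U b = 0) \<or> (\<forall>b\<in>I. W b = 0)"
        by (auto simp: L2_set_eq_0_iff I_def)
      then have "sign_form p \<epsilon> U W = 0"
        unfolding sign_form_def I_def[symmetric] by (auto intro!: sum.neutral)
      with True show ?thesis
        by (auto simp: U_def W_def)
    next
      case False
      then have pos: "L2_set U I > 0" "L2_set W I > 0"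
        using L2_set_nonneg[of U I] L2_set_nonneg[of W I] by linarith+
      have "(\<Sum>t\<in>I \<times> I. \<epsilon> t * c q t) = 5 * sqrt N / (L2_set U I * L2_set W I) * sign_form p \<epsilon> U W"
        unfolding sum_Times sign_form_def I_def[symmetric]
        by (simp add: q_def c_def U_def W_def N_def sum_distrib_left sum_divide_distrib mult_ac)
      then have "5 * sqrt N * sign_form p \<epsilon> U W \<le> 50 * N * (L2_set U I * L2_set W I)"
        using * pos by (simp add: divide_le_eq)
      also have "\<dots> = 5 * sqrt N * (10 * sqrt N * L2_set U I * L2_set W I)"
        using N by simp
      finally have "sign_form p \<epsilon> U W \<le> 10 * sqrt N * L2_set U I * L2_set W I"
        by (rule mult_left_le_imp_le) (use N in simp)
      then show ?thesis
        by (simp add: U_def W_def N_def)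
    qed
  qed
  show ?thesis
    using signs bound unfolding lattice_bounded_def D_def I_def by blast
qed

text \<open>By bilinearity \<open>u\<close> is rounded with \<open>w\<close> fixed, then
  \<open>w\<close> with the rounded \<open>U\<close> fixed. The penalty weight \<open>\<mu>\<close>
  is half the lattice constant, so that
  \<open>2 \<mu> |U| |W| \<le> \<mu> |U|^2 + \<mu> |W|^2\<close> is cancelled by the two penalties
  whatever the norms of \<open>U\<close> and \<open>W\<close> are. What remains is the rounding cost
  \<open>6 \<mu> + 6 \<mu>\<close>.\<close>

lemma sign_form_low_rank_unit:
  fixes y v y' v' :: "nat \<Rightarrow> nat \<Rightarrow> real"
  assumes "p \<ge> 1" "r \<ge> 1"
    and lattice: "lattice_bounded p r \<epsilon>"
  defines "u \<equiv> \<lambda>(a, c). \<Sum>i<r. y i a * v i c" and "w \<equiv> \<lambda>(a, c). \<Sum>i<r. y' i a * v' i c"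
  assumes u: "(\<Sum>b\<in>{..<p} \<times> {..<p}. (u b)\<^sup>2) = 1" and w: "(\<Sum>b\<in>{..<p} \<times> {..<p}. (w b)\<^sup>2) = 1"
  shows "sign_form p \<epsilon> u w \<le> 60 * sqrt (real (r * p))"
proof -
  define I where "I = {..<p} \<times> {..<p}"
  define \<mu> where "\<mu> = 5 * sqrt (real (r * p))"
  have "\<mu> \<ge> 0"
    by (simp add: \<mu>_def)
  obtain Y Z where YZ: "Y \<in> int_ball ({..<r} \<times> {..<p}) (4 * (r * p))" "Z \<in> int_ball ({..<r} \<times> {..<p}) (4 * (r * p))"
    "(\<Sum>b\<in>I. (\<Sum>b'\<in>I. \<epsilon> (b, b') * w b') * u b) \<le> (\<Sum>b\<in>I. (\<Sum>b'\<in>I. \<epsilon> (b, b') * w b') * lattice_mat p r Y Z b)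
      - \<mu> * (\<Sum>b\<in>I. (lattice_mat p r Y Z b)\<^sup>2) + 6 * \<mu>"
    using low_rank_rounding[OF assms(1,2) \<open>\<mu> \<ge> 0\<close> u[unfolded u_def], of "\<lambda>b. \<Sum>b'\<in>I. \<epsilon> (b, b') * w b'"]
    unfolding u_def I_def by blast
  define U where "U = lattice_mat p r Y Z"
  obtain Y' Z' where YZ': "Y' \<in> int_ball ({..<r} \<times> {..<p}) (4 * (r * p))" "Z' \<in> int_ball ({..<r} \<times> {..<p}) (4 * (r * p))"
    "(\<Sum>b'\<in>I. (\<Sum>b\<in>I. \<epsilon> (b, b') * U b) * w b') \<le> (\<Sum>b'\<in>I. (\<Sum>b\<in>I. \<epsilon> (b, b') * U b) * lattice_mat p r Y' Z' b')
      - \<mu> * (\<Sum>b\<in>I. (lattice_mat p r Y' Z' b)\<^sup>2) + 6 * \<mu>"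
    using low_rank_rounding[OF assms(1,2) \<open>\<mu> \<ge> 0\<close> w[unfolded w_def], of "\<lambda>b'. \<Sum>b\<in>I. \<epsilon> (b, b') * U b"]
    unfolding w_def I_def by blast
  define W where "W = lattice_mat p r Y' Z'"
  have form1: "(\<Sum>b\<in>I. (\<Sum>b'\<in>I. \<epsilon> (b, b') * g b') * f b) = sign_form p \<epsilon> f g" for f g
    unfolding sign_form_def I_def[symmetric] by (simp add: sum_distrib_left mult_ac)
  have form2: "(\<Sum>b'\<in>I. (\<Sum>b\<in>I. \<epsilon> (b, b') * f b) * g b') = sign_form p \<epsilon> f g" for f g
    unfolding sign_form_def I_def[symmetric] by (subst sum.swap) (simp add: sum_distrib_left mult_ac)
  have sq: "(\<Sum>b\<in>I. (f b)\<^sup>2) = (L2_set f I)\<^sup>2" for f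
    by (simp add: L2_set_def sum_nonneg)
  have "sign_form p \<epsilon> U W \<le> 2 * \<mu> * (L2_set U I * L2_set W I)"
    using lattice[unfolded lattice_bounded_def, rule_format, OF YZ(1,2) YZ'(1,2)] by (simp add: \<mu>_def U_def W_def I_def)
  also have "\<dots> = \<mu> * (2 * L2_set U I * L2_set W I)"
    by simp
  also have "\<dots> \<le> \<mu> * ((L2_set U I)\<^sup>2 + (L2_set W I)\<^sup>2)"
    using \<open>\<mu> \<ge> 0\<close> by (intro mult_left_mono sum_squares_bound)
  finally have "sign_form p \<epsilon> U W \<le> \<mu> * (L2_set U I)\<^sup>2 + \<mu> * (L2_set W I)\<^sup>2"
    by (simp add: distrib_left)
  moreover have "sign_form p \<epsilon> u w \<le> sign_form p \<epsilon> U w - \<mu> * (L2_set U I)\<^sup>2 + 6 * \<mu>"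
    using YZ(3) unfolding form1 sq U_def .
  moreover have "sign_form p \<epsilon> U w \<le> sign_form p \<epsilon> U W - \<mu> * (L2_set W I)\<^sup>2 + 6 * \<mu>"
    using YZ'(3) unfolding form2 sq W_def .
  ultimately have "sign_form p \<epsilon> u w \<le> 12 * \<mu>"
    by linarith
  then show ?thesis
    by (simp add: \<mu>_def)
qed

section \<open>From real matrices of norm one to complex matrices of low rank\<close>

definition low_rank :: "nat \<Rightarrow> (nat \<times> nat \<Rightarrow> 'a :: comm_semiring_0) \<Rightarrow> bool" where
  "low_rank r u \<longleftrightarrow> (\<exists>y v. u = (\<lambda>(a, c). \<Sum>i<r. y i a * v i c))"

lemma low_rank_sum: "low_rank r (\<lambda>(a, c). \<Sum>i<r. y i a * v i c)"
  unfolding low_rank_def by blast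

lemma low_rank_mult: "low_rank r u \<Longrightarrow> low_rank r (\<lambda>b. t * u b)"
  unfolding low_rank_def
proof (elim exE)
  fix y v assume "u = (\<lambda>(a, c). \<Sum>i<r. y i a * v i c)"
  then have "(\<lambda>b. t * u b) = (\<lambda>(a, c). \<Sum>i<r. (t * y i a) * v i c)"
    by (auto simp: sum_distrib_left mult_ac)
  then show "\<exists>y v. (\<lambda>b. t * u b) = (\<lambda>(a, c). \<Sum>i<r. y i a * v i c)"
    by (intro exI[of _ "\<lambda>i a. t * y i a"] exI[of _ v])
qed

lemma low_rank_add:
  assumes "low_rank r u" "low_rank s w"
  shows "low_rank (r + s) (\<lambda>b. u b + w b)"
proof -
  have append: "(\<Sum>i<r + s. if i < r then f i else g (i - r)) = (\<Sum>i<r. f i) + (\<Sum>i<s. g i)"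
    for f g :: "nat \<Rightarrow> 'a"
    by (induction s) (auto simp: add_ac)
  obtain y v y' v' where eq: "u = (\<lambda>(a, c). \<Sum>i<r. y i a * v i c)" "w = (\<lambda>(a, c). \<Sum>i<s. y' i a * v' i c)"
    using assms unfolding low_rank_def by blast
  define x where "x i = (if i < r then y i else y' (i - r))" for i
  define z where "z i = (if i < r then v i else v' (i - r))" for i
  have "(\<Sum>i<r + s. x i a * z i c) = (\<Sum>i<r. y i a * v i c) + (\<Sum>i<s. y' i a * v' i c)" for a c
    unfolding append[symmetric] by (intro sum.cong) (auto simp: x_def z_def)
  then show ?thesis
    unfolding low_rank_def by (intro exI[of _ x] exI[of _ z]) (auto simp: eq)
qed

text \<open>The real or imaginary part of a product is a combination of two real products, so
  passing to real matrices doubles the rank.\<close>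

lemma low_rank_Re_Im:
  assumes "low_rank k u"
  shows "low_rank (k + k) (\<lambda>b. Re (u b))" "low_rank (k + k) (\<lambda>b. Im (u b))"
proof -
  obtain y v where u: "u = (\<lambda>(a, c). \<Sum>i<k. y i a * v i c)"
    using assms unfolding low_rank_def by blast
  have Re: "(\<lambda>b. Re (u b)) = (\<lambda>b. (case b of (a, c) \<Rightarrow> \<Sum>i<k. Re (y i a) * Re (v i c)) +
      (case b of (a, c) \<Rightarrow> \<Sum>i<k. - Im (y i a) * Im (v i c)))"
    by (auto simp: u sum_subtractf sum_negf)
  show "low_rank (k + k) (\<lambda>b. Re (u b))"
    unfolding Re by (intro low_rank_add low_rank_sum)
  have Im: "(\<lambda>b. Im (u b)) = (\<lambda>b. (case b of (a, c) \<Rightarrow> \<Sum>i<k. Re (y i a) * Im (v i c)) +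
      (case b of (a, c) \<Rightarrow> \<Sum>i<k. Im (y i a) * Re (v i c)))"
    by (auto simp: u sum.distrib)
  show "low_rank (k + k) (\<lambda>b. Im (u b))"
    unfolding Im by (intro low_rank_add low_rank_sum)
qed

lemma sign_form_mult: "sign_form p \<epsilon> (\<lambda>b. s * u b) (\<lambda>b. t * w b) = s * t * sign_form p \<epsilon> u w"
  by (simp add: sign_form_def sum_distrib_left mult_ac)

lemma L2_set_power2: "(L2_set f A)\<^sup>2 = (\<Sum>i\<in>A. (f i)\<^sup>2)"
  by (simp add: L2_set_def sum_nonneg)

text \<open>Homogeneity; the absolute value comes from applying the bound to \<open>- u\<close> as
  well.\<close>

lemma abs_sign_form_le_of_unit:
  assumes unit: "\<And>u w. low_rank r u \<Longrightarrow> low_rank r w \<Longrightarrow>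
      (\<Sum>b\<in>{..<p} \<times> {..<p}. (u b)\<^sup>2) = 1 \<Longrightarrow> (\<Sum>b\<in>{..<p} \<times> {..<p}. (w b)\<^sup>2) = 1 \<Longrightarrow> sign_form p \<epsilon> u w \<le> M"
    and "low_rank r u" "low_rank r w"
  shows "\<bar>sign_form p \<epsilon> u w\<bar> \<le> M * (L2_set u ({..<p} \<times> {..<p}) * L2_set w ({..<p} \<times> {..<p}))"
proof -
  define I where "I = {..<p} \<times> {..<p}"
  show ?thesis
  proof (cases "L2_set u I = 0 \<or> L2_set w I = 0")
    case True
    then have "(\<forall>b\<in>I. u b = 0) \<or> (\<forall>b\<in>I. w b = 0)"
      by (auto simp: L2_set_eq_0_iff I_def)
    then have "sign_form p \<epsilon> u w = 0"
      unfolding sign_form_def I_def[symmetric] by (auto intro!: sum.neutral)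
    with True show ?thesis
      by (auto simp: I_def)
  next
    case False
    then have pos: "L2_set u I > 0" "L2_set w I > 0"
      using L2_set_nonneg[of u I] L2_set_nonneg[of w I] by linarith+
    have le: "\<sigma> * sign_form p \<epsilon> u w \<le> M * (L2_set u I * L2_set w I)" if "\<sigma>\<^sup>2 = 1" for \<sigma> :: real
    proof -
      have norm: "(\<Sum>b\<in>I. (\<sigma> / L2_set u I * u b)\<^sup>2) = 1" "(\<Sum>b\<in>I. (1 / L2_set w I * w b)\<^sup>2) = 1"
        using pos that by (simp_all add: power_mult_distrib power_divide flip: sum_distrib_left sum_divide_distrib L2_set_power2)
      have "sign_form p \<epsilon> (\<lambda>b. \<sigma> / L2_set u I * u b) (\<lambda>b. 1 / L2_set w I * w b) \<le> M"
        using norm assms(2,3) unfolding I_def by (intro unit low_rank_mult)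
      then show ?thesis
        unfolding sign_form_mult using pos by (simp add: divide_le_eq)
    qed
    show ?thesis
      using le[of 1] le[of "- 1"] by (simp add: I_def abs_le_iff)
  qed
qed

definition low_rank_bounded :: "nat \<Rightarrow> nat \<Rightarrow> ((nat \<times> nat) \<times> (nat \<times> nat) \<Rightarrow> real) \<Rightarrow> real \<Rightarrow> bool" where
  "low_rank_bounded p r \<epsilon> M \<longleftrightarrow> (\<forall>u w :: nat \<times> nat \<Rightarrow> complex. low_rank r u \<longrightarrow> low_rank r w \<longrightarrow>
    cmod (\<Sum>b\<in>{..<p} \<times> {..<p}. \<Sum>b'\<in>{..<p} \<times> {..<p}. of_real (\<epsilon> (b, b')) * u b * cnj (w b'))
      \<le> M * (L2_set (\<lambda>b. cmod (u b)) ({..<p} \<times> {..<p}) * L2_set (\<lambda>b. cmod (w b)) ({..<p} \<times> {..<p})))"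

text \<open>Real and imaginary parts have rank at most \<open>2 \<kappa>\<close>, so the signs are
  chosen for the ranks \<open>2 k\<close> and \<open>2 p\<close>. The complex form splits into four
  real ones, each bounded by \<open>60 sqrt (2 \<kappa> p)\<close>, and
  \<open>240 sqrt 2 \<le> 360\<close>.\<close>

lemma exists_signs_low_rank:
  assumes "p \<ge> 1" "k \<ge> 1"
  shows "\<exists>\<epsilon> :: (nat \<times> nat) \<times> (nat \<times> nat) \<Rightarrow> real. (\<forall>t. \<epsilon> t = 1 \<or> \<epsilon> t = - 1) \<and>
    (\<forall>\<kappa>\<in>{k, p}. low_rank_bounded p \<kappa> \<epsilon> (360 * sqrt (real (\<kappa> * p))))"
proof -
  define I where "I = {..<p} \<times> {..<p}"
  have "card {k + k, p + p} \<le> 2"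
    by (cases "k = p") auto
  then obtain \<epsilon> :: "(nat \<times> nat) \<times> (nat \<times> nat) \<Rightarrow> real" where signs: "\<forall>t. \<epsilon> t = 1 \<or> \<epsilon> t = - 1"
    and lattice: "\<forall>r\<in>{k + k, p + p}. lattice_bounded p r \<epsilon>"
    using exists_signs_lattice_mat[of p "{k + k, p + p}"] assms by fastforce
  have "cmod (\<Sum>b\<in>I. \<Sum>b'\<in>I. of_real (\<epsilon> (b, b')) * u b * cnj (w b'))
      \<le> 360 * sqrt (real (\<kappa> * p)) * (L2_set (\<lambda>b. cmod (u b)) I * L2_set (\<lambda>b. cmod (w b)) I)"
    if \<kappa>: "\<kappa> \<in> {k, p}" and u: "low_rank \<kappa> u" and w: "low_rank \<kappa> w" for \<kappa> and u w :: "nat \<times> nat \<Rightarrow> complex"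
  proof -
    define N where "N = sqrt (real ((\<kappa> + \<kappa>) * p))"
    define L where "L = L2_set (\<lambda>b. cmod (u b)) I * L2_set (\<lambda>b. cmod (w b)) I"
    have unit: "sign_form p \<epsilon> f g \<le> 60 * N" if H: "low_rank (\<kappa> + \<kappa>) f" "low_rank (\<kappa> + \<kappa>) g"
        "(\<Sum>b\<in>{..<p} \<times> {..<p}. (f b)\<^sup>2) = 1" "(\<Sum>b\<in>{..<p} \<times> {..<p}. (g b)\<^sup>2) = 1" for f g
    proof -
      obtain y v y' v' where "f = (\<lambda>(a, c). \<Sum>i<\<kappa> + \<kappa>. y i a * v i c)" "g = (\<lambda>(a, c). \<Sum>i<\<kappa> + \<kappa>. y' i a * v' i c)"
        using H(1,2) unfolding low_rank_def by blast
      then show ?thesis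
        using sign_form_low_rank_unit[of p "\<kappa> + \<kappa>" \<epsilon> y v y' v'] H(3,4) \<kappa> assms lattice
        by (auto simp: N_def)
    qed
    have bound: "\<bar>sign_form p \<epsilon> f g\<bar> \<le> 60 * N * L" if "low_rank (\<kappa> + \<kappa>) f" "low_rank (\<kappa> + \<kappa>) g"
        "\<And>b. \<bar>f b\<bar> \<le> cmod (u b)" "\<And>b. \<bar>g b\<bar> \<le> cmod (w b)" for f g
    proof -
      have "L2_set f I * L2_set g I \<le> L"
        unfolding L_def L2_set_def
        using that(3,4) by (intro mult_mono real_sqrt_le_mono sum_mono real_sqrt_ge_zero sum_nonneg)
          (auto simp: abs_le_square_iff[symmetric])
      then have "60 * N * (L2_set f I * L2_set g I) \<le> 60 * N * L"
        by (intro mult_left_mono) (auto simp: N_def)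
      then show ?thesis
        using abs_sign_form_le_of_unit[OF unit that(1,2)] unfolding I_def by linarith
    qed
    define ur ui wr wi where "ur b = Re (u b)" and "ui b = Im (u b)" and "wr b = Re (w b)" and "wi b = Im (w b)" for b
    note parts = ur_def ui_def wr_def wi_def
    have rank: "low_rank (\<kappa> + \<kappa>) ur" "low_rank (\<kappa> + \<kappa>) ui" "low_rank (\<kappa> + \<kappa>) wr" "low_rank (\<kappa> + \<kappa>) wi"
      unfolding parts using low_rank_Re_Im u w by blast+
    have le: "\<And>b. \<bar>ur b\<bar> \<le> cmod (u b)" "\<And>b. \<bar>ui b\<bar> \<le> cmod (u b)" "\<And>b. \<bar>wr b\<bar> \<le> cmod (w b)" "\<And>b. \<bar>wi b\<bar> \<le> cmod (w b)"
      by (auto simp: parts abs_Re_le_cmod abs_Im_le_cmod)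
    define B where "B = (\<Sum>b\<in>I. \<Sum>b'\<in>I. of_real (\<epsilon> (b, b')) * u b * cnj (w b'))"
    have "Re B = sign_form p \<epsilon> ur wr + sign_form p \<epsilon> ui wi"
      by (simp add: B_def sign_form_def I_def parts sum.distrib algebra_simps)
    moreover have "Im B = sign_form p \<epsilon> ui wr - sign_form p \<epsilon> ur wi"
      by (simp add: B_def sign_form_def I_def parts sum_subtractf algebra_simps)
    ultimately have "cmod B \<le> 240 * N * L"
      using cmod_le[of B] bound[OF rank(1,3) le(1,3)] bound[OF rank(2,4) le(2,4)]
        bound[OF rank(2,3) le(2,3)] bound[OF rank(1,4) le(1,4)] by linarith
    also have "\<dots> \<le> 360 * sqrt (real (\<kappa> * p)) * L"
    proof -
      have "N = sqrt 2 * sqrt (real (\<kappa> * p))"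
        by (simp add: N_def algebra_simps flip: real_sqrt_mult)
      moreover have "sqrt 2 \<le> 3 / 2"
        by (rule real_le_lsqrt) (auto simp: power2_eq_square)
      ultimately have "N \<le> 3 / 2 * sqrt (real (\<kappa> * p))"
        by (simp only: mult_right_mono real_sqrt_ge_zero of_nat_0_le_iff)
      moreover have "L \<ge> 0"
        by (simp add: L_def L2_set_nonneg)
      ultimately have "240 * N * L \<le> 240 * (3 / 2 * sqrt (real (\<kappa> * p))) * L"
        by (intro mult_right_mono mult_left_mono) auto
      then show ?thesis by simp
    qed
    finally show ?thesis
      by (simp add: B_def L_def)
  qed
  with signs show ?thesis
    unfolding low_rank_bounded_def I_def by blast
qed

section \<open>Positive semidefinite matrices\<close>

lemma sum_lessThan_eq_pair:
  fixes f :: "nat \<Rightarrow> 'a :: comm_monoid_add"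
  assumes "i < m" "j < m" "i \<noteq> j" "\<And>l. l < m \<Longrightarrow> l \<noteq> i \<Longrightarrow> l \<noteq> j \<Longrightarrow> f l = 0"
  shows "(\<Sum>l<m. f l) = f i + f j"
proof -
  have "(\<Sum>l<m. f l) = (\<Sum>l\<in>{i, j}. f l)"
    using assms by (intro sum.mono_neutral_right) auto
  then show ?thesis
    using assms(3) by simp
qed

text \<open>Matrices as functions, so that an induction on the size can drop the last index without
  changing the carrier.\<close>

definition quad_fun :: "nat \<Rightarrow> (nat \<Rightarrow> nat \<Rightarrow> complex) \<Rightarrow> (nat \<Rightarrow> complex) \<Rightarrow> complex" where
  "quad_fun m X v = (\<Sum>i<m. \<Sum>j<m. cnj (v i) * X i j * v j)"

lemma quad_fun_pair:
  assumes "i < m" "j < m" "i \<noteq> j"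
  shows "quad_fun m X (\<lambda>l. if l = i then s else if l = j then t else 0) =
    cnj s * X i i * s + cnj s * X i j * t + (cnj t * X j i * s + cnj t * X j j * t)"
  unfolding quad_fun_def using assms
  by (subst sum_lessThan_eq_pair[of i m j]; (subst sum_lessThan_eq_pair[of i m j])?) (auto simp: sum_lessThan_eq_pair[of i m j])

lemma quad_fun_single:
  assumes "i < m"
  shows "quad_fun m X (\<lambda>l. if l = i then 1 else 0) = X i i"
proof -
  have "quad_fun m X (\<lambda>l. if l = i then 1 else 0) = (\<Sum>a<m. \<Sum>b<m. if b = i then if a = i then X i i else 0 else 0)"
    unfolding quad_fun_def by (intro sum.cong) auto
  then show ?thesis
    using assms by simp
qed

text \<open>Polarisation: the diagonal is real by testing on unit vectors, and the vectors with
  entry \<open>1\<close> at \<open>i\<close> and entry \<open>1\<close> or \<open>\<i>\<close> at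
  \<open>j\<close> determine the off-diagonal pair.\<close>

lemma hermitian_of_real_quad_fun:
  assumes real: "\<And>v. Im (quad_fun m X v) = 0" and ij: "i < m" "j < m"
  shows "X j i = cnj (X i j)"
proof (cases "i = j")
  case True
  have "quad_fun m X (\<lambda>l. if l = i then 1 else 0) = X i i"
    using ij by (intro quad_fun_single)
  then have "Im (X i i) = 0"
    using real by metis
  with True show ?thesis
    by (simp add: complex_eq_iff)
next
  case False
  have "quad_fun m X (\<lambda>l. if l = i then 1 else 0) = X i i" "quad_fun m X (\<lambda>l. if l = j then 1 else 0) = X j j"
    using ij by (simp_all add: quad_fun_single)
  then have "Im (X i i) = 0" "Im (X j j) = 0"
    using real by metis+
  moreover have "Im (cnj 1 * X i i * 1 + cnj 1 * X i j * t + (cnj t * X j i * 1 + cnj t * X j j * t)) = 0" for t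
    using real[of "\<lambda>l. if l = i then 1 else if l = j then t else 0"] unfolding quad_fun_pair[OF ij False] .
  from this[of 1] this[of \<i>] have "Im (X i i + X i j + (X j i + X j j)) = 0"
    "Im (X i i + X i j * \<i> + (- \<i> * X j i + X j j)) = 0"
    by simp_all
  ultimately show ?thesis
    by (simp add: complex_eq_iff)
qed

text \<open>Elimination of the last index: subtracting \<open>X i N * X N j / X N N\<close> leaves a positive
  semidefinite form (the Schur complement). If \<open>X N N = 0\<close> the junk value of the division is harmless,
  since then the whole last column vanishes.\<close>

lemma psd_sum_of_rank_one:
  fixes X :: "nat \<Rightarrow> nat \<Rightarrow> complex"
  assumes "\<And>i j. i < N \<Longrightarrow> j < N \<Longrightarrow> X j i = cnj (X i j)" and "\<And>v. Re (quad_fun N X v) \<ge> 0"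
  shows "\<exists>\<xi> :: nat \<Rightarrow> nat \<Rightarrow> complex. \<forall>i<N. \<forall>j<N. X i j = (\<Sum>l<N. \<xi> l i * cnj (\<xi> l j))"
  using assms
proof (induction N arbitrary: X)
  case (Suc N)
  note herm = Suc.prems(1) and psd = Suc.prems(2)
  define d where "d = Re (X N N)"
  have XNN: "X N N = of_real d"
    using herm[of N N] by (simp add: d_def complex_eq_iff)
  have "quad_fun (Suc N) X (\<lambda>l. if l = N then 1 else 0) = X N N"
    by (intro quad_fun_single) simp
  then have d: "d \<ge> 0"
    using psd d_def by metis
  have col0: "X i N = 0" if "d = 0" "i < N" for i
  proof (rule ccontr)
    assume "X i N \<noteq> 0"
    define e where "e = Re (X i i)"
    have "quad_fun (Suc N) X (\<lambda>l. if l = i then 1 else 0) = X i i"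
      using that by (intro quad_fun_single) simp
    then have "e \<ge> 0"
      using psd e_def by metis
    \<comment> \<open>With \<open>d = 0\<close> the form at the vector with entries \<open>s\<close>
      and \<open>1\<close> has a linear term in \<open>s\<close> that can outweigh the quadratic
      one. This \<open>s\<close> gives \<open>|X i N|^2 (e - 2 (e + 1)) / (e + 1)^2 < 0\<close>;
      using \<open>e + 1\<close> instead of \<open>e\<close> avoids a zero denominator.\<close>
    define s where "s = - complex_of_real (1 / (e + 1)) * X i N"
    have eq: "quad_fun (Suc N) X (\<lambda>l. if l = i then s else if l = N then 1 else 0) =
        cnj s * X i i * s + cnj s * X i N * 1 + (cnj 1 * X N i * s + cnj 1 * X N N * 1)"
      using that by (intro quad_fun_pair) auto
    have "Re (cnj s * X i i * s + cnj s * X i N * 1 + (cnj 1 * X N i * s + cnj 1 * X N N * 1)) \<ge> 0"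
      using psd[of "\<lambda>l. if l = i then s else if l = N then 1 else 0"] unfolding eq .
    also have "cnj s * X i i * s + cnj s * X i N * 1 + (cnj 1 * X N i * s + cnj 1 * X N N * 1)
        = X i i * (s * cnj s) + (X i N * cnj s + cnj (X i N * cnj s))"
      using XNN that herm[of i N] by simp
    also have "s * cnj s = of_real ((1 / (e + 1))\<^sup>2) * (X i N * cnj (X i N))"
      by (simp add: s_def power2_eq_square)
    also have "X i N * cnj s = - (of_real (1 / (e + 1)) * (X i N * cnj (X i N)))"
      by (simp add: s_def)
    also have "X i N * cnj (X i N) = of_real ((cmod (X i N))\<^sup>2)"
      by (rule complex_norm_square[symmetric])
    finally have "0 \<le> e * ((cmod (X i N))\<^sup>2 / (e + 1)\<^sup>2) - 2 * ((cmod (X i N))\<^sup>2 / (e + 1))"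
      by (simp add: e_def power_divide flip: of_real_power)
    also have "(cmod (X i N))\<^sup>2 / (e + 1) = (cmod (X i N))\<^sup>2 / (e + 1)\<^sup>2 * (e + 1)"
      using \<open>e \<ge> 0\<close> by (simp add: power2_eq_square)
    also have "e * ((cmod (X i N))\<^sup>2 / (e + 1)\<^sup>2) - 2 * ((cmod (X i N))\<^sup>2 / (e + 1)\<^sup>2 * (e + 1))
        = (cmod (X i N))\<^sup>2 / (e + 1)\<^sup>2 * (e - 2 * (e + 1))"
    proof -
      have "e * y - 2 * (y * f) = y * (e - 2 * f)" for y f :: real
        by (simp add: algebra_simps)
      then show ?thesis .
    qed
    also have "\<dots> < 0"
      using \<open>e \<ge> 0\<close> \<open>X i N \<noteq> 0\<close> by (intro mult_pos_neg) auto
    finally show False by simp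
  qed
  define S where "S i j = X i j - X i N * X N j / of_real d" for i j
  have "Re (quad_fun N S v) \<ge> 0" for v
  proof -
    define s where "s = (\<Sum>j<N. X N j * v j)"
    have s_cnj: "(\<Sum>i<N. cnj (v i) * X i N) = cnj s"
      using herm[of N] by (simp add: s_def mult_ac)
    \<comment> \<open>Completing the square: for \<open>d > 0\<close> this last coordinate minimises
      the form of \<open>X\<close>, and the minimum is the form of \<open>S\<close>. For
      \<open>d = 0\<close> both \<open>t = 0\<close> and \<open>S = X\<close>.\<close>
    define t where "t = - s / of_real d"
    define v' where "v' = (\<lambda>l. if l = N then t else v l)"
    have "quad_fun (Suc N) X v' = quad_fun N X v + (\<Sum>i<N. cnj (v i) * X i N) * t
        + cnj t * (\<Sum>j<N. X N j * v j) + cnj t * X N N * t"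
      by (simp add: quad_fun_def v'_def sum.distrib sum_distrib_left sum_distrib_right mult_ac)
    also have "\<dots> = quad_fun N X v - cnj s * s / of_real d"
      by (simp add: s_cnj s_def[symmetric] XNN t_def)
    also have "\<dots> = quad_fun N S v"
    proof -
      have "quad_fun N S v = quad_fun N X v - (\<Sum>i<N. \<Sum>j<N. (cnj (v i) * X i N) * (X N j * v j)) / of_real d"
      proof -
        have "cnj (v i) * S i j * v j = cnj (v i) * X i j * v j - (cnj (v i) * X i N) * (X N j * v j) / of_real d" for i j
          by (simp add: S_def algebra_simps)
        then show ?thesis
          by (simp only: quad_fun_def sum_subtractf sum_divide_distrib)
      qed
      then show ?thesis
        by (simp add: s_cnj s_def[symmetric] flip: sum_product)
    qed
    finally show ?thesis
      using psd[of v'] by simp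
  qed
  moreover have "S j i = cnj (S i j)" if "i < N" "j < N" for i j
    using herm[of i j] herm[of i N] herm[of j N] that by (simp add: S_def mult_ac)
  ultimately obtain \<xi> where \<xi>: "\<forall>i<N. \<forall>j<N. S i j = (\<Sum>l<N. \<xi> l i * cnj (\<xi> l j))"
    using Suc.IH[of S] by blast
  \<comment> \<open>The normalised last column is the new rank-one term; the vectors decomposing
    \<open>S\<close> are extended by \<open>0\<close>.\<close>
  define \<xi>' where "\<xi>' l i = (if l = N then X i N / of_real (sqrt d) else if i = N then 0 else \<xi> l i)" for l i
  have "X i j = (\<Sum>l<Suc N. \<xi>' l i * cnj (\<xi>' l j))" if "i < Suc N" "j < Suc N" for i j
  proof -
    have "\<xi>' N i * cnj (\<xi>' N j) = X i N * X N j / (of_real (sqrt d) * of_real (sqrt d))"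
      using herm[of j N] that by (simp add: \<xi>'_def)
    also have "complex_of_real (sqrt d) * of_real (sqrt d) = of_real d"
      using d by (simp flip: of_real_mult)
    finally have last: "\<xi>' N i * cnj (\<xi>' N j) = X i N * X N j / of_real d" .
    show ?thesis
    proof (cases "i = N \<or> j = N")
      case True
      then have "(\<Sum>l<N. \<xi>' l i * cnj (\<xi>' l j)) = 0"
        by (intro sum.neutral) (auto simp: \<xi>'_def)
      moreover have "X i j = X i N * X N j / of_real d"
      proof (cases "d = 0")
        case True
        have "X N i = 0" if "i < N" for i
          using herm[of i N] col0[OF True that] that by simp
        then show ?thesis
          using True \<open>i = N \<or> j = N\<close> col0 XNN that by (auto simp: less_Suc_eq)
      qed (use True XNN in auto)
      ultimately show ?thesis
        by (simp add: last)
    next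
      case False
      then have "(\<Sum>l<N. \<xi>' l i * cnj (\<xi>' l j)) = S i j"
        using \<xi> that by (auto simp: \<xi>'_def less_Suc_eq)
      then show ?thesis
        by (simp add: last S_def)
    qed
  qed
  then show ?case by blast
qed simp

lemma quad_form_eq_quad_fun: "A \<in> carrier_mat m m \<Longrightarrow> quad_form A v = quad_fun m (\<lambda>i j. A $$ (i, j)) (\<lambda>i. v $ i)"
  by (simp add: quad_form_def quad_fun_def)

text \<open>\<open>psd_mat\<close> only asks for real nonnegative values of the form; the Hermitian
  symmetry needed for the decomposition follows from this.\<close>

lemma psd_mat_sum_of_rank_one:
  assumes "psd_mat m A"
  obtains \<xi> :: "nat \<Rightarrow> nat \<Rightarrow> complex"
  where "\<And>i j. i < m \<Longrightarrow> j < m \<Longrightarrow> A $$ (i, j) = (\<Sum>l<m. \<xi> l i * cnj (\<xi> l j))"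
proof -
  have A: "A \<in> carrier_mat m m"
    using assms by (simp add: psd_mat_def)
  have "quad_fun m (\<lambda>i j. A $$ (i, j)) v = quad_form A (vec m v)" for v
    using A by (simp add: quad_form_eq_quad_fun quad_fun_def)
  then have real: "Im (quad_fun m (\<lambda>i j. A $$ (i, j)) v) = 0" and nonneg: "Re (quad_fun m (\<lambda>i j. A $$ (i, j)) v) \<ge> 0" for v
    using assms by (simp_all add: psd_mat_def)
  from psd_sum_of_rank_one[OF hermitian_of_real_quad_fun[OF real] nonneg]
  show ?thesis
    using that by blast
qed

section \<open>The map and its \<open>k\<close>-positivity\<close>

lemma sum_lessThan_mult:
  "(\<Sum>\<alpha><k * n. f \<alpha>) = (\<Sum>i<k. \<Sum>c<n. f (i * n + c :: nat))"
  unfolding sum.nat_group[symmetric]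
  by (rule sum.cong[OF refl], subst sum.atLeastLessThan_shift_0) (simp add: lessThan_atLeast0)

lemma div_mod_mult_add: "c < n \<Longrightarrow> (i * n + c) div n = (i :: nat)" "c < n \<Longrightarrow> (i * n + c) mod n = (c :: nat)"
  by auto

lemma mult_add_less: "i < k \<Longrightarrow> c < n \<Longrightarrow> i * n + c < k * (n :: nat)"
  by (metis div_less_iff_less_mult div_mod_mult_add(1) gr_zeroI not_less_zero)

text \<open>Entry \<open>(c, d)\<close> of the sign matrix \<open>G\<^sub>a\<^sub>b\<close> is
  \<open>\<epsilon> ((a, c), (b, d))\<close>. Grouping an index of the argument with an index of the
  value makes \<open>\<epsilon>\<close> a form in two matrices \<open>u\<^sub>a\<^sub>c\<close> and
  \<open>w\<^sub>b\<^sub>d\<close>.\<close>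

definition corner_map :: "nat \<Rightarrow> nat \<Rightarrow> real \<Rightarrow> ((nat \<times> nat) \<times> (nat \<times> nat) \<Rightarrow> real) \<Rightarrow> complex mat \<Rightarrow> complex mat" where
  "corner_map n p s \<epsilon> X = mat n n (\<lambda>(c, d).
    (if c = d then (\<Sum>a<n. X $$ (a, a)) / of_nat n else 0) +
    (if c < p \<and> d < p then of_real s * (\<Sum>a<p. \<Sum>b<p.
      of_real (\<epsilon> ((a, c), (b, d))) * X $$ (a, p + b) + of_real (\<epsilon> ((a, d), (b, c))) * X $$ (p + b, a)) else 0))"

lemma corner_map_carrier [simp]: "corner_map n p s \<epsilon> X \<in> carrier_mat n n"
  by (simp add: corner_map_def)

lemma dim_corner_map [simp]: "dim_row (corner_map n p s \<epsilon> X) = n" "dim_col (corner_map n p s \<epsilon> X) = n"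
  by (simp_all add: corner_map_def)

lemma linear_corner_map:
  assumes "2 * p \<le> n"
  shows "linear_map_Mn n (corner_map n p s \<epsilon>)"
  unfolding linear_map_Mn_def
proof (intro conjI ballI allI)
  show "corner_map n p s \<epsilon> X \<in> carrier_mat n n" for X
    by simp
  fix X Y :: "complex mat" and t :: complex
  assume XY: "X \<in> carrier_mat n n" "Y \<in> carrier_mat n n"
  have entry: "(t \<cdot>\<^sub>m X + Y) $$ (i, j) = t * X $$ (i, j) + Y $$ (i, j)" if "i < n" "j < n" for i j
    using XY that by simp
  show "corner_map n p s \<epsilon> (t \<cdot>\<^sub>m X + Y) = t \<cdot>\<^sub>m corner_map n p s \<epsilon> X + corner_map n p s \<epsilon> Y"
  proof (rule eq_matI)
    fix c d assume "c < dim_row (t \<cdot>\<^sub>m corner_map n p s \<epsilon> X + corner_map n p s \<epsilon> Y)"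
      "d < dim_col (t \<cdot>\<^sub>m corner_map n p s \<epsilon> X + corner_map n p s \<epsilon> Y)"
    then have cd: "c < n" "d < n"
      by (auto simp: corner_map_def)
    have 1: "(\<Sum>a<n. (t \<cdot>\<^sub>m X + Y) $$ (a, a)) = t * (\<Sum>a<n. X $$ (a, a)) + (\<Sum>a<n. Y $$ (a, a))"
      by (simp add: entry sum.distrib sum_distrib_left del: index_add_mat index_smult_mat)
    define F where "F X = (\<Sum>a<p. \<Sum>b<p.
      of_real (\<epsilon> ((a, c), (b, d))) * X $$ (a, p + b) + of_real (\<epsilon> ((a, d), (b, c))) * X $$ (p + b, a))" for X :: "complex mat"
    have 2: "F (t \<cdot>\<^sub>m X + Y) = t * F X + F Y"
      using assms by (simp add: F_def entry sum.distrib sum_distrib_left algebra_simps del: index_add_mat index_smult_mat)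
    have "corner_map n p s \<epsilon> X $$ (c, d) = (if c = d then (\<Sum>a<n. X $$ (a, a)) / of_nat n else 0) +
        (if c < p \<and> d < p then of_real s * F X else 0)" for X
      using cd by (simp add: corner_map_def F_def)
    then show "corner_map n p s \<epsilon> (t \<cdot>\<^sub>m X + Y) $$ (c, d) = (t \<cdot>\<^sub>m corner_map n p s \<epsilon> X + corner_map n p s \<epsilon> Y) $$ (c, d)"
      using cd by (simp add: 1 2 add_divide_distrib distrib_left mult_ac)
  qed auto
qed

lemma unital_corner_map:
  assumes "2 * p \<le> n" "n \<ge> 1"
  shows "unital_Mn n (corner_map n p s \<epsilon>)"
  unfolding unital_Mn_def
proof (rule eq_matI)
  fix c d assume "c < dim_row (1\<^sub>m n :: complex mat)" "d < dim_col (1\<^sub>m n :: complex mat)"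
  moreover have "(\<Sum>a<p. \<Sum>b<p. of_real (\<epsilon> ((a, c), (b, d))) * 1\<^sub>m n $$ (a, p + b) +
      complex_of_real (\<epsilon> ((a, d), (b, c))) * 1\<^sub>m n $$ (p + b, a)) = 0"
    using assms by (intro sum.neutral ballI) auto
  ultimately show "corner_map n p s \<epsilon> (1\<^sub>m n) $$ (c, d) = 1\<^sub>m n $$ (c, d)"
    using assms by (simp add: corner_map_def)
qed auto

lemma corner_map_entry:
  assumes "c < n" "d < n"
  shows "corner_map n p s \<epsilon> X $$ (c, d) =
    (if c = d then (\<Sum>a<n. X $$ (a, a)) / of_nat n else 0) +
    (if c < p \<and> d < p then of_real s * (\<Sum>a<p. \<Sum>b<p.
      of_real (\<epsilon> ((a, c), (b, d))) * X $$ (a, p + b) + of_real (\<epsilon> ((a, d), (b, c))) * X $$ (p + b, a)) else 0)"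
  using assms by (simp add: corner_map_def)

lemma block_entry: "r < n \<Longrightarrow> t < n \<Longrightarrow> block n X i j $$ (r, t) = X $$ (i * n + r, j * n + t)"
  by (simp add: block_def)

lemma ampl_entry:
  assumes "i < k" "j < k" "c < n" "d < n"
  shows "ampl k n \<Phi> X $$ (i * n + c, j * n + d) = \<Phi> (block n X i j) $$ (c, d)"
  using assms by (simp add: ampl_def mult_add_less)

text \<open>Here \<open>X\<close> and \<open>v\<close> enter only through \<open>W\<close>, in which
  both block indices, running below \<open>k\<close>, are summed out. For \<open>X\<close> of rank
  one, \<open>W\<close> factors into a matrix of rank at most \<open>k\<close> and a
  conjugate.\<close>

lemma quad_form_ampl_corner_map:
  fixes X :: "complex mat" and v :: "complex vec" and k :: nat
  assumes "2 * p \<le> n"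
  defines "W \<equiv> \<lambda>a c b d. \<Sum>i<k. \<Sum>j<k. cnj (v $ (i * n + c)) * X $$ (i * n + a, j * n + b) * v $ (j * n + d)"
  shows "quad_form (ampl k n (corner_map n p s \<epsilon>) X) v =
    (\<Sum>c<n. \<Sum>a<n. W a c a c) / of_nat n + of_real s * (\<Sum>c<p. \<Sum>d<p. \<Sum>a<p. \<Sum>b<p.
      of_real (\<epsilon> ((a, c), (b, d))) * W a c (p + b) d + of_real (\<epsilon> ((a, d), (b, c))) * W (p + b) c a d)"
proof -
  define \<Phi> where "\<Phi> = corner_map n p s \<epsilon>"
  \<comment> \<open>As a linear functional of the scalar block entries, \<open>L\<close> can be
    pushed through the formula for the map by its linearity rules, instead of exchanging nested sums
    by hand.\<close>
  define L where "L c d x = (\<Sum>i<k. \<Sum>j<k. cnj (v $ (i * n + c)) * x i j * v $ (j * n + d))"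
    for c d and x :: "nat \<Rightarrow> nat \<Rightarrow> complex"
  have L_add: "L c d (\<lambda>i j. x i j + y i j) = L c d x + L c d y" for c d x y
    by (simp add: L_def sum.distrib distrib_left distrib_right)
  have L_mult: "L c d (\<lambda>i j. t * x i j) = t * L c d x" for c d x t
    by (simp add: L_def sum_distrib_left mult_ac)
  have L_sum: "L c d (\<lambda>i j. \<Sum>a<m. x a i j) = (\<Sum>a<m. L c d (x a))" for c d m and x :: "nat \<Rightarrow> nat \<Rightarrow> nat \<Rightarrow> complex"
    by (induction m) (simp_all add: L_add, simp add: L_def)
  have L_if: "L c d (\<lambda>i j. if P then x i j else 0) = (if P then L c d x else 0)" for c d x P
    by (simp add: L_def)
  have L_W: "L c d (\<lambda>i j. X $$ (i * n + a, j * n + b)) = W a c b d" for a b c d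
    by (simp add: L_def W_def)
  have "quad_form (ampl k n \<Phi> X) v = (\<Sum>i<k. \<Sum>c<n. \<Sum>j<k. \<Sum>d<n.
      cnj (v $ (i * n + c)) * \<Phi> (block n X i j) $$ (c, d) * v $ (j * n + d))"
    unfolding quad_form_def by (simp add: sum_lessThan_mult ampl_entry ampl_def[THEN arg_cong[of _ _ dim_row]] ampl_def[THEN arg_cong[of _ _ dim_col]])
  also have "\<dots> = (\<Sum>c<n. \<Sum>i<k. \<Sum>j<k. \<Sum>d<n.
      cnj (v $ (i * n + c)) * \<Phi> (block n X i j) $$ (c, d) * v $ (j * n + d))"
    by (rule sum.swap)
  also have "\<dots> = (\<Sum>c<n. \<Sum>d<n. L c d (\<lambda>i j. \<Phi> (block n X i j) $$ (c, d)))"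
  proof (rule sum.cong[OF refl])
    fix c
    have "(\<Sum>i<k. \<Sum>j<k. \<Sum>d<n. cnj (v $ (i * n + c)) * \<Phi> (block n X i j) $$ (c, d) * v $ (j * n + d))
      = (\<Sum>i<k. \<Sum>d<n. \<Sum>j<k. cnj (v $ (i * n + c)) * \<Phi> (block n X i j) $$ (c, d) * v $ (j * n + d))"
      by (intro sum.cong[OF refl] sum.swap)
    also have "\<dots> = (\<Sum>d<n. L c d (\<lambda>i j. \<Phi> (block n X i j) $$ (c, d)))"
      unfolding L_def by (rule sum.swap)
    finally show "(\<Sum>i<k. \<Sum>j<k. \<Sum>d<n. cnj (v $ (i * n + c)) * \<Phi> (block n X i j) $$ (c, d) * v $ (j * n + d))
      = (\<Sum>d<n. L c d (\<lambda>i j. \<Phi> (block n X i j) $$ (c, d)))" .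
  qed
  also have "\<dots> = (\<Sum>c<n. \<Sum>d<n. (if c = d then (1 / of_nat n) * (\<Sum>a<n. W a c a d) else 0) +
    (if c < p \<and> d < p then of_real s * (\<Sum>a<p. \<Sum>b<p.
      of_real (\<epsilon> ((a, c), (b, d))) * W a c (p + b) d + of_real (\<epsilon> ((a, d), (b, c))) * W (p + b) c a d) else 0))"
  proof (intro sum.cong[OF refl])
    fix c d assume "c \<in> {..<n}" "d \<in> {..<n}"
    then have cd: "c < n" "d < n" by auto
    have "\<Phi> (block n X i j) $$ (c, d) = (if c = d then (1 / of_nat n) * (\<Sum>a<n. X $$ (i * n + a, j * n + a)) else 0) +
      (if c < p \<and> d < p then of_real s * (\<Sum>a<p. \<Sum>b<p. of_real (\<epsilon> ((a, c), (b, d))) * X $$ (i * n + a, j * n + (p + b)) +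
        of_real (\<epsilon> ((a, d), (b, c))) * X $$ (i * n + (p + b), j * n + a)) else 0)" for i j
      using assms(1) by (simp add: \<Phi>_def corner_map_entry[OF cd] block_entry)
    then have "L c d (\<lambda>i j. \<Phi> (block n X i j) $$ (c, d)) =
      L c d (\<lambda>i j. (if c = d then (1 / of_nat n) * (\<Sum>a<n. X $$ (i * n + a, j * n + a)) else 0) +
      (if c < p \<and> d < p then of_real s * (\<Sum>a<p. \<Sum>b<p. of_real (\<epsilon> ((a, c), (b, d))) * X $$ (i * n + a, j * n + (p + b)) +
        of_real (\<epsilon> ((a, d), (b, c))) * X $$ (i * n + (p + b), j * n + a)) else 0))"
      by presburger
    then show "L c d (\<lambda>i j. \<Phi> (block n X i j) $$ (c, d)) = (if c = d then (1 / of_nat n) * (\<Sum>a<n. W a c a d) else 0) +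
      (if c < p \<and> d < p then of_real s * (\<Sum>a<p. \<Sum>b<p.
        of_real (\<epsilon> ((a, c), (b, d))) * W a c (p + b) d + of_real (\<epsilon> ((a, d), (b, c))) * W (p + b) c a d) else 0)"
      by (simp only: L_add L_mult L_sum L_if L_W)
  qed
  also have "\<dots> = (\<Sum>c<n. \<Sum>d<n. if c = d then (1 / of_nat n) * (\<Sum>a<n. W a c a d) else 0) +
    (\<Sum>c<n. \<Sum>d<n. if c < p \<and> d < p then of_real s * (\<Sum>a<p. \<Sum>b<p.
      of_real (\<epsilon> ((a, c), (b, d))) * W a c (p + b) d + of_real (\<epsilon> ((a, d), (b, c))) * W (p + b) c a d) else 0)"
    by (simp only: sum.distrib)
  also have "(\<Sum>c<n. \<Sum>d<n. if c = d then (1 / of_nat n) * (\<Sum>a<n. W a c a d) else 0) = (\<Sum>c<n. \<Sum>a<n. W a c a c) / of_nat n"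
    by (simp add: sum_divide_distrib)
  also have "(\<Sum>c<n. \<Sum>d<n. if c < p \<and> d < p then g c d else 0) = (\<Sum>c<p. \<Sum>d<p. g c d)" for g :: "nat \<Rightarrow> nat \<Rightarrow> complex"
  proof -
    have "(\<Sum>c<n. \<Sum>d<n. if c < p \<and> d < p then g c d else 0) = (\<Sum>c<p. \<Sum>d<n. if c < p \<and> d < p then g c d else 0)"
      using assms(1) by (intro sum.mono_neutral_right) auto
    also have "\<dots> = (\<Sum>c<p. \<Sum>d<p. if c < p \<and> d < p then g c d else 0)"
      using assms(1) by (intro sum.cong sum.mono_neutral_right) auto
    finally show ?thesis by simp
  qed
  finally show ?thesis
    by (simp add: \<Phi>_def flip: sum_distrib_left)
qed

text \<open>Each rank-one term \<open>\<xi> l\<close> contributes \<open>|u|^2 / n\<close> through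
  the trace and \<open>2 s Re B\<close> through the corner. Now \<open>|B| \<le> M f g\<close> by
  the rank-\<open>k\<close> bound, and \<open>s M n \<le> 1\<close> with
  \<open>2 f g \<le> f^2 + g^2 \<le> |u|^2\<close> lets the trace part absorb the corner
  part.\<close>

lemma k_positive_corner_map:
  assumes "2 * p \<le> n" "s \<ge> 0" "s * M * real n \<le> 1"
    and form: "low_rank_bounded p k \<epsilon> M"
  shows "k_positive_Mn k n (corner_map n p s \<epsilon>)"
  unfolding k_positive_Mn_def
proof (intro allI impI)
  fix X assume "psd_mat (k * n) X"
  then obtain \<xi> :: "nat \<Rightarrow> nat \<Rightarrow> complex" where \<xi>: "\<And>i j. i < k * n \<Longrightarrow> j < k * n \<Longrightarrow>
      X $$ (i, j) = (\<Sum>l<k * n. \<xi> l i * cnj (\<xi> l j))"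
    using psd_mat_sum_of_rank_one by blast
  define I where "I = {..<p} \<times> {..<p}"
  have "Im (quad_form (ampl k n (corner_map n p s \<epsilon>) X) v) = 0 \<and> Re (quad_form (ampl k n (corner_map n p s \<epsilon>) X) v) \<ge> 0" for v
  proof -
    \<comment> \<open>A sum of \<open>k\<close> products, hence of rank at most \<open>k\<close>:
      this is where the order of positivity enters.\<close>
    define u where "u l a c = (\<Sum>i<k. \<xi> l (i * n + a) * cnj (v $ (i * n + c)))" for l a c
    define B where "B l = (\<Sum>b\<in>I. \<Sum>b'\<in>I. of_real (\<epsilon> (b, b')) * (case b of (a, c) \<Rightarrow> u l a c) * cnj (case b' of (b, d) \<Rightarrow> u l (p + b) d))" for l
    define G where "G l = (\<Sum>a<n. \<Sum>c<n. (cmod (u l a c))\<^sup>2)" for l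
    have W: "(\<Sum>i<k. \<Sum>j<k. cnj (v $ (i * n + c)) * X $$ (i * n + a, j * n + b) * v $ (j * n + d))
        = (\<Sum>l<k * n. u l a c * cnj (u l b d))" if "a < n" "b < n" for a b c d
    proof -
      have "(\<Sum>l<k * n. u l a c * cnj (u l b d)) = (\<Sum>l<k * n. \<Sum>i<k. \<Sum>j<k.
          cnj (v $ (i * n + c)) * (\<xi> l (i * n + a) * cnj (\<xi> l (j * n + b))) * v $ (j * n + d))"
        unfolding u_def cnj_sum sum_product by (simp add: mult_ac)
      also have "\<dots> = (\<Sum>i<k. \<Sum>l<k * n. \<Sum>j<k.
          cnj (v $ (i * n + c)) * (\<xi> l (i * n + a) * cnj (\<xi> l (j * n + b))) * v $ (j * n + d))"
        by (rule sum.swap)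
      also have "\<dots> = (\<Sum>i<k. \<Sum>j<k. \<Sum>l<k * n.
          cnj (v $ (i * n + c)) * (\<xi> l (i * n + a) * cnj (\<xi> l (j * n + b))) * v $ (j * n + d))"
        by (intro sum.cong[OF refl] sum.swap)
      also have "\<dots> = (\<Sum>i<k. \<Sum>j<k. cnj (v $ (i * n + c)) * X $$ (i * n + a, j * n + b) * v $ (j * n + d))"
        using that by (intro sum.cong[OF refl]) (simp add: \<xi> mult_add_less sum_distrib_left sum_distrib_right)
      finally show ?thesis ..
    qed
    have diag: "(\<Sum>c<n. \<Sum>a<n. \<Sum>l<k * n. u l a c * cnj (u l a c)) = (\<Sum>l<k * n. of_real (G l))"
    proof -
      have "(\<Sum>c<n. \<Sum>a<n. \<Sum>l<k * n. u l a c * cnj (u l a c)) = (\<Sum>a<n. \<Sum>c<n. \<Sum>l<k * n. of_real ((cmod (u l a c))\<^sup>2))"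
        by (subst sum.swap) (simp only: complex_norm_square)
      also have "\<dots> = (\<Sum>l<k * n. \<Sum>a<n. \<Sum>c<n. of_real ((cmod (u l a c))\<^sup>2))"
        by (subst sum.swap[of _ _ "{..<n}"], subst sum.swap[of _ "{..<k * n}" "{..<n}"]) simp
      finally show ?thesis
        by (simp add: G_def)
    qed
    have B_eq: "B l = (\<Sum>c<p. \<Sum>d<p. \<Sum>a<p. \<Sum>b<p. of_real (\<epsilon> ((a, c), (b, d))) * (u l a c * cnj (u l (p + b) d)))" for l
    proof -
      have "B l = (\<Sum>a<p. \<Sum>c<p. \<Sum>b<p. \<Sum>d<p. of_real (\<epsilon> ((a, c), (b, d))) * (u l a c * cnj (u l (p + b) d)))"
        by (simp add: B_def I_def sum_Times mult.assoc)
      also have "\<dots> = (\<Sum>c<p. \<Sum>a<p. \<Sum>b<p. \<Sum>d<p. of_real (\<epsilon> ((a, c), (b, d))) * (u l a c * cnj (u l (p + b) d)))"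
        by (rule sum.swap)
      also have "\<dots> = (\<Sum>c<p. \<Sum>a<p. \<Sum>d<p. \<Sum>b<p. of_real (\<epsilon> ((a, c), (b, d))) * (u l a c * cnj (u l (p + b) d)))"
        by (intro sum.cong[OF refl] sum.swap)
      also have "\<dots> = (\<Sum>c<p. \<Sum>d<p. \<Sum>a<p. \<Sum>b<p. of_real (\<epsilon> ((a, c), (b, d))) * (u l a c * cnj (u l (p + b) d)))"
        by (intro sum.cong[OF refl] sum.swap)
      finally show ?thesis .
    qed
    \<comment> \<open>Conjugation with \<open>c\<close> and \<open>d\<close> exchanged produces
      exactly the adjoint term of the map.\<close>
    have cnj_B_eq: "cnj (B l) = (\<Sum>c<p. \<Sum>d<p. \<Sum>a<p. \<Sum>b<p. of_real (\<epsilon> ((a, d), (b, c))) * (u l (p + b) c * cnj (u l a d)))" for l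
      unfolding B_eq by (subst sum.swap) (simp add: mult_ac)
    have pull: "(\<Sum>c<p. \<Sum>d<p. \<Sum>a<p. \<Sum>b<p. e a b c d * (\<Sum>l<m. g l a b c d)) =
        (\<Sum>l<m. \<Sum>c<p. \<Sum>d<p. \<Sum>a<p. \<Sum>b<p. e a b c d * g l a b c d)" for m e and g :: "nat \<Rightarrow> nat \<Rightarrow> nat \<Rightarrow> nat \<Rightarrow> nat \<Rightarrow> complex"
      by (induction m) (simp_all add: distrib_left sum.distrib)
    have "quad_form (ampl k n (corner_map n p s \<epsilon>) X) v = (\<Sum>c<n. \<Sum>a<n. \<Sum>l<k * n. u l a c * cnj (u l a c)) / of_nat n +
      of_real s * (\<Sum>c<p. \<Sum>d<p. \<Sum>a<p. \<Sum>b<p. of_real (\<epsilon> ((a, c), (b, d))) * (\<Sum>l<k * n. u l a c * cnj (u l (p + b) d)) +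
        of_real (\<epsilon> ((a, d), (b, c))) * (\<Sum>l<k * n. u l (p + b) c * cnj (u l a d)))"
      using assms(1) unfolding quad_form_ampl_corner_map[OF assms(1)] by (simp add: W)
    also have "\<dots> = (\<Sum>l<k * n. of_real (G l)) / of_nat n + of_real s * ((\<Sum>l<k * n. B l) + (\<Sum>l<k * n. cnj (B l)))"
      by (simp only: diag sum.distrib pull flip: B_eq cnj_B_eq)
    also have "\<dots> = of_real (\<Sum>l<k * n. G l / real n + s * (2 * Re (B l)))"
      by (simp add: complex_add_cnj sum.distrib sum_divide_distrib sum_distrib_left flip: sum.distrib distrib_left)
    finally have quad: "quad_form (ampl k n (corner_map n p s \<epsilon>) X) v = of_real (\<Sum>l<k * n. G l / real n + s * (2 * Re (B l)))" .
    have "0 \<le> G l / real n + s * (2 * Re (B l))" for l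
    proof (cases "n = 0")
      case True
      then show ?thesis
        using assms(1) by (simp add: B_def I_def G_def)
    next
      case False
      define f where "f = L2_set (\<lambda>b. cmod (case b of (a, c) \<Rightarrow> u l a c)) I"
      define g where "g = L2_set (\<lambda>b. cmod (case b of (b, d) \<Rightarrow> u l (p + b) d)) I"
      have "low_rank k (\<lambda>(a, c). u l a c)"
        unfolding u_def by (rule low_rank_sum)
      moreover have "low_rank k (\<lambda>(b, d). u l (p + b) d)"
        unfolding u_def by (rule low_rank_sum)
      ultimately have "cmod (B l) \<le> M * (f * g)"
        using form[unfolded low_rank_bounded_def, rule_format, of "\<lambda>(a, c). u l a c" "\<lambda>(b, d). u l (p + b) d"] by (simp add: B_def f_def g_def I_def)
      then have "- Re (B l) \<le> M * (f * g)"
        using abs_Re_le_cmod[of "B l"] by linarith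
      then have "s * (2 * (- Re (B l))) \<le> s * (2 * (M * (f * g)))"
        using assms(2) by (intro mult_left_mono) auto
      also have "\<dots> = (s * M * real n) * ((2 * f * g) / real n)"
        using False by simp
      also have "\<dots> \<le> 1 * ((2 * f * g) / real n)"
        using assms(3) by (intro mult_right_mono) (auto simp: f_def g_def L2_set_nonneg)
      also have "\<dots> \<le> (f\<^sup>2 + g\<^sup>2) / real n"
        using sum_squares_bound[of f g] by (simp add: divide_right_mono)
      \<comment> \<open>\<open>f\<close> and \<open>g\<close> see the disjoint row ranges
        \<open>[0, p)\<close> and \<open>[p, 2 p)\<close> of the same matrix.\<close>
      also have "f\<^sup>2 + g\<^sup>2 \<le> G l"
      proof -
        have "f\<^sup>2 + g\<^sup>2 = (\<Sum>a<p. \<Sum>c<p. (cmod (u l a c))\<^sup>2) + (\<Sum>b<p. \<Sum>d<p. (cmod (u l (p + b) d))\<^sup>2)"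
          by (simp add: f_def g_def L2_set_power2 I_def sum_Times)
        also have "\<dots> \<le> (\<Sum>a<p. \<Sum>c<n. (cmod (u l a c))\<^sup>2) + (\<Sum>b<p. \<Sum>d<n. (cmod (u l (p + b) d))\<^sup>2)"
          using assms(1) by (intro add_mono sum_mono sum_mono2) auto
        also have "\<dots> = (\<Sum>a<2 * p. \<Sum>c<n. (cmod (u l a c))\<^sup>2)"
          using sum_lessThan_mult[of "\<lambda>a. \<Sum>c<n. (cmod (u l a c))\<^sup>2" 2 p] by (simp add: numeral_2_eq_2)
        also have "\<dots> \<le> G l"
          unfolding G_def using assms(1) by (intro sum_mono2) (auto intro: sum_nonneg)
        finally show ?thesis .
      qed
      finally show ?thesis
        by (simp add: divide_right_mono)
    qed
    then have "0 \<le> (\<Sum>l<k * n. G l / real n + s * (2 * Re (B l)))"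
      by (intro sum_nonneg)
    then show ?thesis
      unfolding quad Re_complex_of_real Im_complex_of_real by simp
  qed
  then show "psd_mat (k * n) (ampl k n (corner_map n p s \<epsilon>) X)"
    by (simp add: psd_mat_def ampl_def)
qed

section \<open>Lower bound for the completely bounded norm\<close>

lemma vnorm_eq_L2_set: "vnorm v = L2_set (\<lambda>i. cmod (v $ i)) {..<dim_vec v}"
  by (simp add: vnorm_def L2_set_def)

lemma vnorm_nonneg: "vnorm v \<ge> 0"
  by (simp add: vnorm_eq_L2_set L2_set_nonneg)

lemma vnorm_zero: "vnorm (0\<^sub>v m) = 0"
  by (simp add: vnorm_def)

lemma op_norm_le:
  assumes "\<And>v. v \<in> carrier_vec (dim_col A) \<Longrightarrow> vnorm v \<le> 1 \<Longrightarrow> vnorm (A *\<^sub>v v) \<le> C"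
  shows "op_norm A \<le> C"
  unfolding op_norm_def
proof (rule cSup_least)
  have "vnorm (A *\<^sub>v 0\<^sub>v (dim_col A)) \<in> {vnorm (A *\<^sub>v v) |v. v \<in> carrier_vec (dim_col A) \<and> vnorm v \<le> 1}"
    using vnorm_zero[of "dim_col A"] by force
  then show "{vnorm (A *\<^sub>v v) |v. v \<in> carrier_vec (dim_col A) \<and> vnorm v \<le> 1} \<noteq> {}"
    by blast
qed (use assms in auto)

lemma mult_mat_vec_entry:
  "i < dim_row A \<Longrightarrow> v \<in> carrier_vec (dim_col A) \<Longrightarrow> (A *\<^sub>v v) $ i = (\<Sum>j<dim_col A. A $$ (i, j) * v $ j)"
  by (auto simp: scalar_prod_def lessThan_atLeast0 intro!: sum.cong)

text \<open>A real supremum is only meaningful over a bounded set; the sum of the moduli of all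
  entries is a crude but sufficient bound.\<close>

lemma vnorm_mult_le_op_norm:
  assumes v: "v \<in> carrier_vec (dim_col A)" "vnorm v \<le> 1"
  shows "vnorm (A *\<^sub>v v) \<le> op_norm A"
  unfolding op_norm_def
proof (rule cSup_upper)
  show "vnorm (A *\<^sub>v v) \<in> {vnorm (A *\<^sub>v v) |v. v \<in> carrier_vec (dim_col A) \<and> vnorm v \<le> 1}"
    using v by blast
  have "vnorm (A *\<^sub>v v) \<le> (\<Sum>i<dim_row A. \<Sum>j<dim_col A. cmod (A $$ (i, j)))"
    if v: "v \<in> carrier_vec (dim_col A)" "vnorm v \<le> 1" for v
  proof -
    have entry: "cmod (v $ j) \<le> 1" if "j < dim_col A" for j
    proof -
      have "cmod (v $ j) \<le> vnorm v"
        unfolding vnorm_eq_L2_set using v that by (intro member_le_L2_set) auto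
      with v show ?thesis by simp
    qed
    have "vnorm (A *\<^sub>v v) \<le> (\<Sum>i<dim_row A. cmod ((A *\<^sub>v v) $ i))"
      unfolding vnorm_eq_L2_set by (rule order.trans[OF L2_set_le_sum]) auto
    also have "\<dots> \<le> (\<Sum>i<dim_row A. \<Sum>j<dim_col A. cmod (A $$ (i, j)))"
    proof (rule sum_mono)
      fix i assume "i \<in> {..<dim_row A}"
      then have "cmod ((A *\<^sub>v v) $ i) = cmod (\<Sum>j<dim_col A. A $$ (i, j) * v $ j)"
        using v by (subst mult_mat_vec_entry) auto
      also have "\<dots> \<le> (\<Sum>j<dim_col A. cmod (A $$ (i, j)) * cmod (v $ j))"
        by (rule order.trans[OF norm_sum]) (simp add: norm_mult)
      also have "\<dots> \<le> (\<Sum>j<dim_col A. cmod (A $$ (i, j)))"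
        using entry by (intro sum_mono mult_right_le_one_le) auto
      finally show "cmod ((A *\<^sub>v v) $ i) \<le> (\<Sum>j<dim_col A. cmod (A $$ (i, j)))" .
    qed
    finally show ?thesis .
  qed
  then show "bdd_above {vnorm (A *\<^sub>v v) |v. v \<in> carrier_vec (dim_col A) \<and> vnorm v \<le> 1}"
    by (intro bdd_aboveI[of _ "\<Sum>i<dim_row A. \<Sum>j<dim_col A. cmod (A $$ (i, j))"]) auto
qed

text \<open>Cauchy-Schwarz.\<close>

lemma Re_quad_form_le_op_norm:
  assumes A: "A \<in> carrier_mat m m" and v: "v \<in> carrier_vec m" "vnorm v \<le> 1"
  shows "Re (quad_form A v) \<le> op_norm A"
proof -
  define z where "z = A *\<^sub>v v"
  have z: "dim_vec z = m" "\<And>i. i < m \<Longrightarrow> z $ i = (\<Sum>j<m. A $$ (i, j) * v $ j)"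
    using A v mult_mat_vec_entry[of _ A v] by (auto simp: z_def)
  have "quad_form A v = (\<Sum>i<m. cnj (v $ i) * z $ i)"
    using A z(2) by (simp add: quad_form_def sum_distrib_left mult.assoc)
  then have "Re (quad_form A v) \<le> cmod (\<Sum>i<m. cnj (v $ i) * z $ i)"
    by (metis complex_Re_le_cmod)
  also have "\<dots> \<le> (\<Sum>i<m. \<bar>cmod (v $ i)\<bar> * \<bar>cmod (z $ i)\<bar>)"
    by (rule order.trans[OF norm_sum]) (simp add: norm_mult)
  also have "\<dots> \<le> vnorm v * vnorm z"
    using L2_set_mult_ineq[of "\<lambda>i. cmod (v $ i)" "\<lambda>i. cmod (z $ i)" "{..<m}"] v z by (simp add: vnorm_eq_L2_set)
  also have "\<dots> \<le> 1 * vnorm z"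
    using v by (intro mult_right_mono vnorm_nonneg) auto
  also have "\<dots> \<le> op_norm A"
    using vnorm_mult_le_op_norm[of v A] A v by (simp add: z_def)
  finally show ?thesis .
qed

lemma op_norm_le_cb_norm:
  assumes "m \<ge> 1" "Y \<in> carrier_mat (m * n) (m * n)" "op_norm Y \<le> 1"
  shows "ereal (op_norm (ampl m n \<Phi> Y)) \<le> cb_norm n \<Phi>"
proof -
  have "ereal (op_norm (ampl m n \<Phi> Y)) \<le> ampl_norm m n \<Phi>"
    unfolding ampl_norm_def using assms by (intro SUP_upper) auto
  also have "\<dots> \<le> cb_norm n \<Phi>"
    unfolding cb_norm_def using assms by (intro SUP_upper) auto
  finally show ?thesis .
qed

text \<open>A \<open>p \<times> p\<close> array of blocks, each supported in the corner read by the
  first term of the map. Block \<open>(c, d)\<close> holds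
  \<open>\<epsilon> ((a, c), (b, d)) / M\<close> at position \<open>(a, p + b)\<close>, the very
  signs by which the map multiplies that position in its output entry \<open>(c, d)\<close>.\<close>

definition sign_block_mat :: "nat \<Rightarrow> nat \<Rightarrow> real \<Rightarrow> ((nat \<times> nat) \<times> (nat \<times> nat) \<Rightarrow> real) \<Rightarrow> complex mat" where
  "sign_block_mat n p M \<epsilon> = mat (p * n) (p * n) (\<lambda>(\<alpha>, \<beta>).
    if \<alpha> mod n < p \<and> p \<le> \<beta> mod n \<and> \<beta> mod n < 2 * p
    then of_real (\<epsilon> ((\<alpha> mod n, \<alpha> div n), (\<beta> mod n - p, \<beta> div n)) / M) else 0)"

lemma sign_block_mat_entry:
  assumes "c < p" "d < p" "a < n" "b < n"
  shows "sign_block_mat n p M \<epsilon> $$ (c * n + a, d * n + b) =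
    (if a < p \<and> p \<le> b \<and> b < 2 * p then of_real (\<epsilon> ((a, c), (b - p, d)) / M) else 0)"
  using assms by (simp add: sign_block_mat_def mult_add_less)

text \<open>For \<open>z = A v\<close>, \<open>|z|^2\<close> is the inner product of
  \<open>z\<close> with \<open>A v\<close>, that is, the sign form divided by \<open>M\<close>. It
  is therefore at most \<open>|z| |v|\<close>, and one factor \<open>|z|\<close> cancels.\<close>

lemma op_norm_sign_block_mat_le_1:
  assumes "2 * p \<le> n" "M > 0"
    and form: "low_rank_bounded p p \<epsilon> M"
  shows "op_norm (sign_block_mat n p M \<epsilon>) \<le> 1"
proof (rule op_norm_le)
  define A where "A = sign_block_mat n p M \<epsilon>"
  have A: "dim_row A = p * n" "dim_col A = p * n"
    by (simp_all add: A_def sign_block_mat_def)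
  fix v :: "complex vec" assume "v \<in> carrier_vec (dim_col (sign_block_mat n p M \<epsilon>))" and v1: "vnorm v \<le> 1"
  then have v: "v \<in> carrier_vec (p * n)"
    using A by (simp add: A_def)
  define I where "I = {..<p} \<times> {..<p}"
  define z where "z = A *\<^sub>v v"
  have dz: "dim_vec z = p * n"
    by (simp add: z_def A)
  \<comment> \<open>Cut off beyond row \<open>p\<close>, because \<open>low_rank\<close> speaks
    about all index pairs.\<close>
  define u where "u = (\<lambda>(a, c). if a < p then cnj (z $ (c * n + a)) else 0)"
  define w where "w = (\<lambda>(b, d). if b < p then cnj (v $ (d * n + (p + b))) else 0)"
  \<comment> \<open>Only \<open>p\<close> rows are nonzero, so the identity matrix serves as first
    factor.\<close>
  have rank: "low_rank p f" if "\<And>a c. a \<ge> p \<Longrightarrow> f (a, c) = 0" for f :: "nat \<times> nat \<Rightarrow> complex"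
  proof -
    have expand: "f (a, c) = (\<Sum>i<p. (if i = a then 1 else 0) * f (i, c))" for a c
      using that[of a c] by (simp add: if_distrib[of "\<lambda>t. t * _"] cong: if_cong)
    have "f b = (case b of (a, c) \<Rightarrow> \<Sum>i<p. (if i = a then 1 else 0) * f (i, c))" for b
    proof (cases b)
      case (Pair a c)
      show ?thesis
        unfolding Pair prod.case by (rule expand)
    qed
    then have eq: "f = (\<lambda>(a, c). \<Sum>i<p. (if i = a then 1 else 0) * f (i, c))"
      by (rule ext)
    show ?thesis
      by (subst eq) (rule low_rank_sum)
  qed
  have z_entry: "z $ (c * n + a) = (if a < p then (\<Sum>d<p. \<Sum>b<p. of_real (\<epsilon> ((a, c), (b, d)) / M) * v $ (d * n + (p + b))) else 0)"
    if "c < p" "a < n" for a c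
  proof -
    have "z $ (c * n + a) = (\<Sum>d<p. \<Sum>b<n. A $$ (c * n + a, d * n + b) * v $ (d * n + b))"
      using mult_mat_vec_entry[of "c * n + a" A v] A v that by (simp add: z_def mult_add_less sum_lessThan_mult)
    also have "\<dots> = (\<Sum>d<p. \<Sum>b<n. if a < p \<and> p \<le> b \<and> b < 2 * p then of_real (\<epsilon> ((a, c), (b - p, d)) / M) * v $ (d * n + b) else 0)"
      using that by (intro sum.cong[OF refl]) (simp add: A_def sign_block_mat_entry)
    also have "\<dots> = (\<Sum>d<p. \<Sum>b\<in>{p..<2 * p}. if a < p then of_real (\<epsilon> ((a, c), (b - p, d)) / M) * v $ (d * n + b) else 0)"
      using assms(1) by (intro sum.cong[OF refl] sum.mono_neutral_cong_right) auto
    also have "\<dots> = (\<Sum>d<p. \<Sum>b<p. if a < p then of_real (\<epsilon> ((a, c), (b, d)) / M) * v $ (d * n + (p + b)) else 0)"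
      by (intro sum.cong[OF refl], subst sum.atLeastLessThan_shift_0) (simp add: lessThan_atLeast0 cong: if_cong)
    finally show ?thesis by simp
  qed
  have norm_u: "L2_set (\<lambda>b. cmod (u b)) I \<le> vnorm z"
  proof -
    have "(\<Sum>b\<in>I. (cmod (u b))\<^sup>2) = (\<Sum>c<p. \<Sum>a<p. (cmod (z $ (c * n + a)))\<^sup>2)"
      unfolding I_def sum_Times by (subst sum.swap) (simp add: u_def)
    also have "\<dots> \<le> (\<Sum>c<p. \<Sum>a<n. (cmod (z $ (c * n + a)))\<^sup>2)"
      using assms(1) by (intro sum_mono sum_mono2) auto
    finally show ?thesis
      by (simp add: L2_set_def vnorm_def dz sum_lessThan_mult)
  qed
  have norm_w: "L2_set (\<lambda>b. cmod (w b)) I \<le> 1"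
  proof -
    have "(\<Sum>b\<in>I. (cmod (w b))\<^sup>2) = (\<Sum>d<p. \<Sum>b<p. (cmod (v $ (d * n + (p + b))))\<^sup>2)"
      unfolding I_def sum_Times by (subst sum.swap) (simp add: w_def)
    also have "\<dots> = (\<Sum>d<p. \<Sum>b\<in>{p..<2 * p}. (cmod (v $ (d * n + b)))\<^sup>2)"
      by (intro sum.cong[OF refl], subst sum.atLeastLessThan_shift_0) (simp add: lessThan_atLeast0)
    also have "\<dots> \<le> (\<Sum>d<p. \<Sum>b<n. (cmod (v $ (d * n + b)))\<^sup>2)"
      using assms(1) by (intro sum_mono sum_mono2) auto
    finally have "L2_set (\<lambda>b. cmod (w b)) I \<le> vnorm v"
      using v by (simp add: L2_set_def vnorm_def sum_lessThan_mult)
    with v1 show ?thesis by simp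
  qed
  have "of_real ((vnorm z)\<^sup>2) = (\<Sum>c<p. \<Sum>a<n. cnj (z $ (c * n + a)) * z $ (c * n + a))"
  proof -
    have "complex_of_real ((cmod x)\<^sup>2) = cnj x * x" for x
      by (simp only: complex_norm_square mult.commute)
    then show ?thesis
      by (simp only: vnorm_eq_L2_set L2_set_power2 dz sum_lessThan_mult of_real_sum)
  qed
  also have "\<dots> = (\<Sum>c<p. \<Sum>a<p. cnj (z $ (c * n + a)) * z $ (c * n + a))"
    using assms(1) by (intro sum.cong[OF refl] sum.mono_neutral_right) (auto simp: z_entry)
  also have "\<dots> = (\<Sum>c<p. \<Sum>a<p. \<Sum>d<p. \<Sum>b<p. of_real (\<epsilon> ((a, c), (b, d))) * u (a, c) * cnj (w (b, d)) / of_real M)"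
  proof (intro sum.cong[OF refl])
    fix c a assume ca: "c \<in> {..<p}" "a \<in> {..<p}"
    then have "z $ (c * n + a) = (\<Sum>d<p. \<Sum>b<p. of_real (\<epsilon> ((a, c), (b, d)) / M) * v $ (d * n + (p + b)))"
      using assms(1) by (subst z_entry) auto
    then have "cnj (z $ (c * n + a)) * z $ (c * n + a) = u (a, c) * (\<Sum>d<p. \<Sum>b<p. of_real (\<epsilon> ((a, c), (b, d)) / M) * v $ (d * n + (p + b)))"
      using ca by (simp add: u_def)
    then show "cnj (z $ (c * n + a)) * z $ (c * n + a) = (\<Sum>d<p. \<Sum>b<p. of_real (\<epsilon> ((a, c), (b, d))) * u (a, c) * cnj (w (b, d)) / of_real M)"
      by (simp add: w_def sum_distrib_left mult_ac)
  qed
  also have "\<dots> = (\<Sum>a<p. \<Sum>c<p. \<Sum>b<p. \<Sum>d<p. of_real (\<epsilon> ((a, c), (b, d))) * u (a, c) * cnj (w (b, d)) / of_real M)"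
    by (subst sum.swap) (intro sum.cong[OF refl] sum.swap)
  also have "\<dots> = (\<Sum>b\<in>I. \<Sum>b'\<in>I. of_real (\<epsilon> (b, b')) * u b * cnj (w b')) / of_real M"
    by (simp add: I_def sum_Times sum_divide_distrib)
  finally have "(vnorm z)\<^sup>2 = cmod ((\<Sum>b\<in>I. \<Sum>b'\<in>I. of_real (\<epsilon> (b, b')) * u b * cnj (w b')) / of_real M)"
    by (metis abs_power2 norm_of_real)
  also have "\<dots> = cmod (\<Sum>b\<in>I. \<Sum>b'\<in>I. of_real (\<epsilon> (b, b')) * u b * cnj (w b')) / M"
    using assms(2) by (simp add: norm_divide)
  also have "\<dots> \<le> (M * (L2_set (\<lambda>b. cmod (u b)) I * L2_set (\<lambda>b. cmod (w b)) I)) / M"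
    using assms(2) unfolding I_def by (intro divide_right_mono form[unfolded low_rank_bounded_def, rule_format] rank) (auto simp: u_def w_def)
  also have "\<dots> = L2_set (\<lambda>b. cmod (u b)) I * L2_set (\<lambda>b. cmod (w b)) I"
    using assms(2) by simp
  also have "\<dots> \<le> vnorm z * 1"
    using norm_u norm_w by (intro mult_mono) (auto simp: L2_set_nonneg vnorm_nonneg)
  finally have "vnorm z * vnorm z \<le> vnorm z * 1"
    by (simp add: power2_eq_square)
  then have "vnorm z \<le> 1"
    using vnorm_nonneg[of z] by (cases "vnorm z = 0") (auto simp: mult_le_cancel_left)
  then show "vnorm (sign_block_mat n p M \<epsilon> *\<^sub>v v) \<le> 1"
    by (simp add: z_def A_def)
qed

text \<open>The signs of the map meet themselves, so all \<open>p^2\<close> terms equal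
  \<open>1 / M\<close>. The trace and the adjoint term vanish because the block lives in a single
  off-diagonal corner.\<close>

lemma ampl_corner_map_sign_block_mat_diag:
  assumes "2 * p \<le> n" "c < p" "d < p" and signs: "\<And>t. \<epsilon> t = 1 \<or> \<epsilon> t = - 1"
  shows "ampl p n (corner_map n p s \<epsilon>) (sign_block_mat n p M \<epsilon>) $$ (c * n + c, d * n + d) = of_real (s * (real p)\<^sup>2 / M)"
proof -
  define Y where "Y = sign_block_mat n p M \<epsilon>"
  have block: "block n Y c d $$ (a, b) = (if a < p \<and> p \<le> b \<and> b < 2 * p then of_real (\<epsilon> ((a, c), (b - p, d)) / M) else 0)"
    if "a < n" "b < n" for a b
    using that assms(2,3) by (simp add: Y_def block_entry sign_block_mat_entry)
  have sq: "complex_of_real (\<epsilon> t) * of_real (\<epsilon> t) = 1" for t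
    using signs[of t] by auto
  have cd: "c < n" "d < n"
    using assms(1-3) by auto
  have trace: "(\<Sum>a<n. block n Y c d $$ (a, a)) = 0"
    by (intro sum.neutral) (auto simp: block)
  have "(\<Sum>a<p. \<Sum>b<p. of_real (\<epsilon> ((a, c), (b, d))) * block n Y c d $$ (a, p + b) +
      of_real (\<epsilon> ((a, d), (b, c))) * block n Y c d $$ (p + b, a)) = (\<Sum>a<p. \<Sum>b<p. complex_of_real (1 / M))"
    using assms(1) sq by (intro sum.cong[OF refl]) (simp add: block)
  also have "\<dots> = of_real ((real p)\<^sup>2 / M)"
    by (simp add: power2_eq_square)
  finally have "corner_map n p s \<epsilon> (block n Y c d) $$ (c, d) = of_real (s * (real p)\<^sup>2 / M)"
    unfolding corner_map_entry[OF cd] trace using assms(2,3) by simp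
  then show ?thesis
    using assms(1-3) by (simp add: ampl_entry Y_def)
qed

text \<open>The maximally entangled vector \<open>\<Omega>\<close>, using the first \<open>p\<close>
  of the \<open>n\<close> coordinates, averages \<open>p^2\<close> equal entries with weight
  \<open>1 / p\<close> each.\<close>

lemma op_norm_ampl_corner_map_ge:
  assumes "2 * p \<le> n" "p \<ge> 1" and signs: "\<And>t. \<epsilon> t = 1 \<or> \<epsilon> t = - 1"
  shows "s * (real p)^3 / M \<le> op_norm (ampl p n (corner_map n p s \<epsilon>) (sign_block_mat n p M \<epsilon>))"
proof -
  define A where "A = ampl p n (corner_map n p s \<epsilon>) (sign_block_mat n p M \<epsilon>)"
  have A: "A \<in> carrier_mat (p * n) (p * n)"
    by (simp add: A_def ampl_def)
  define \<Omega> :: "complex vec" where "\<Omega> = vec (p * n) (\<lambda>\<alpha>. if \<alpha> div n = \<alpha> mod n then of_real (1 / sqrt (real p)) else 0)"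
  have \<Omega>_entry: "\<Omega> $ (c * n + a) = (if c = a then of_real (1 / sqrt (real p)) else 0)" if "c < p" "a < n" for c a
    using that by (simp add: \<Omega>_def mult_add_less)
  have \<Omega>: "\<Omega> \<in> carrier_vec (p * n)"
    by (simp add: \<Omega>_def)
  have delta: "(\<Sum>c<p. \<Sum>a<n. if c = a then f c a else 0) = (\<Sum>c<p. f c c)" for f :: "nat \<Rightarrow> nat \<Rightarrow> 'b :: comm_monoid_add"
    using assms(1) by (intro sum.cong) auto
  have "(\<Sum>i<p * n. (cmod (\<Omega> $ i))\<^sup>2) = (\<Sum>c<p. \<Sum>a<n. if c = a then 1 / real p else 0)"
    unfolding sum_lessThan_mult by (intro sum.cong[OF refl]) (simp add: \<Omega>_entry norm_divide power_divide)
  also have "\<dots> = 1"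
    unfolding delta using assms(2) by simp
  finally have norm: "vnorm \<Omega> \<le> 1"
    using \<Omega> by (simp add: vnorm_def)
  have "quad_form A \<Omega> = (\<Sum>c<p. \<Sum>a<n. \<Sum>d<p. \<Sum>b<n. cnj (\<Omega> $ (c * n + a)) * A $$ (c * n + a, d * n + b) * \<Omega> $ (d * n + b))"
    using A by (simp add: quad_form_def sum_lessThan_mult)
  also have "\<dots> = (\<Sum>c<p. \<Sum>a<n. if c = a then \<Sum>d<p. \<Sum>b<n. if d = b then of_real (1 / real p) * A $$ (c * n + a, d * n + b) else 0 else 0)"
  proof (intro sum.cong[OF refl])
    fix c a assume ca: "c \<in> {..<p}" "a \<in> {..<n}"
    have sq: "complex_of_real (1 / sqrt (real p)) * x * of_real (1 / sqrt (real p)) = of_real (1 / real p) * x" for x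
      by (simp flip: of_real_mult)
    have "(\<Sum>d<p. \<Sum>b<n. cnj (\<Omega> $ (c * n + a)) * A $$ (c * n + a, d * n + b) * \<Omega> $ (d * n + b)) =
      (\<Sum>d<p. \<Sum>b<n. if c = a then if d = b then of_real (1 / real p) * A $$ (c * n + a, d * n + b) else 0 else 0)"
      using ca by (intro sum.cong[OF refl]) (simp add: \<Omega>_entry sq[simplified])
    then show "(\<Sum>d<p. \<Sum>b<n. cnj (\<Omega> $ (c * n + a)) * A $$ (c * n + a, d * n + b) * \<Omega> $ (d * n + b)) =
      (if c = a then \<Sum>d<p. \<Sum>b<n. if d = b then of_real (1 / real p) * A $$ (c * n + a, d * n + b) else 0 else 0)"
      by simp
  qed
  also have "\<dots> = (\<Sum>c<p. \<Sum>d<p. of_real (1 / real p) * A $$ (c * n + c, d * n + d))"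
    unfolding delta ..
  also have "\<dots> = (\<Sum>c<p. \<Sum>d<p. of_real (1 / real p) * of_real (s * (real p)\<^sup>2 / M))"
    unfolding A_def using assms by (intro sum.cong[OF refl]) (simp add: ampl_corner_map_sign_block_mat_diag)
  also have "\<dots> = of_real (s * (real p)^3 / M)"
    using assms(2) by (simp add: power2_eq_square power3_eq_cube)
  finally have "Re (quad_form A \<Omega>) = s * (real p)^3 / M"
    by simp
  then show ?thesis
    using Re_quad_form_le_op_norm[OF A \<Omega> norm] by (simp add: A_def)
qed

section \<open>Choice of the parameters and the case of dimension one\<close>

lemma exists_map_of_dim_ge_2:
  assumes "n \<ge> 2" "k \<ge> 1"
  shows "\<exists>\<Phi>. linear_map_Mn n \<Phi> \<and> unital_Mn n \<Phi> \<and> k_positive_Mn k n \<Phi> \<and>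
    cb_norm n \<Phi> \<ge> ereal (1 / (6 * 360\<^sup>2) * sqrt (real n / real k))"
proof -
  define p where "p = n div 2"
  have p: "p \<ge> 1" "2 * p \<le> n" "n \<le> 3 * p"
    using assms(1) by (auto simp: p_def)
  obtain \<epsilon> :: "(nat \<times> nat) \<times> (nat \<times> nat) \<Rightarrow> real" where signs: "\<And>t. \<epsilon> t = 1 \<or> \<epsilon> t = - 1"
    and bounded: "low_rank_bounded p k \<epsilon> (360 * sqrt (real (k * p)))" "low_rank_bounded p p \<epsilon> (360 * sqrt (real (p * p)))"
    using exists_signs_low_rank[OF p(1) assms(2)] by auto
  define M where "M = 360 * sqrt (real (k * p))"
  define M' where "M' = 360 * real p"
  define s where "s = 1 / (M * real n)"
  have pos: "M > 0" "M' > 0"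
    using p assms by (simp_all add: M_def M'_def)
  define \<Phi> where "\<Phi> = corner_map n p s \<epsilon>"
  have kpos: "k_positive_Mn k n \<Phi>"
    unfolding \<Phi>_def
  proof (rule k_positive_corner_map[OF p(2)])
    show "s \<ge> 0" "s * M * real n \<le> 1"
      using pos by (auto simp: s_def)
    show "low_rank_bounded p k \<epsilon> M"
      using bounded(1) by (simp only: M_def)
  qed
  have "op_norm (sign_block_mat n p M' \<epsilon>) \<le> 1"
    using bounded(2) by (intro op_norm_sign_block_mat_le_1 p(2) pos(2)) (simp add: M'_def)
  then have "ereal (op_norm (ampl p n \<Phi> (sign_block_mat n p M' \<epsilon>))) \<le> cb_norm n \<Phi>"
    using p by (intro op_norm_le_cb_norm) (auto simp: sign_block_mat_def)
  moreover have "1 / (6 * 360\<^sup>2) * sqrt (real n / real k) \<le> op_norm (ampl p n \<Phi> (sign_block_mat n p M' \<epsilon>))"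
  proof -
    define N where "N = real n"
    define P where "P = real p"
    define K where "K = real k"
    have NPK: "P \<ge> 1" "N \<le> 3 * P" "K \<ge> 1" "N \<ge> 1"
      using p assms by (auto simp: N_def P_def K_def)
    \<comment> \<open>From \<open>N \<le> 3 P\<close> one gets
      \<open>N sqrt N \<le> 6 P sqrt P\<close>; this accounts for the \<open>6\<close> in the
      constant, while each of \<open>M\<close> and \<open>M'\<close> contributes a factor
      \<open>360\<close>.\<close>
    have "sqrt N \<le> 2 * sqrt P"
      using NPK by (intro real_le_lsqrt) (auto simp: power_mult_distrib)
    then have "N * sqrt N \<le> (3 * P) * (2 * sqrt P)"
      using NPK by (intro mult_mono) auto
    then have "sqrt N / sqrt K / 6 \<le> P * sqrt P / (N * sqrt K)"
      using NPK by (simp add: field_simps)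
    also have "\<dots> = P\<^sup>2 / (N * (sqrt K * sqrt P))"
    proof -
      have "q * q * q / (N * t) = (q * q)\<^sup>2 / (N * (t * q))" if "q > 0" "t > 0" for q t
        using that NPK by (simp add: field_simps power2_eq_square)
      from this[of "sqrt P" "sqrt K"] show ?thesis
        using NPK by simp
    qed
    finally have "sqrt N / sqrt K / 6 / 360\<^sup>2 \<le> P\<^sup>2 / (N * (sqrt K * sqrt P)) / 360\<^sup>2"
      by (intro divide_right_mono) auto
    also have "\<dots> = s * P ^ 3 / M'"
      using NPK by (simp add: s_def M_def M'_def N_def[symmetric] P_def[symmetric] K_def[symmetric] real_sqrt_mult power3_eq_cube power2_eq_square)
    also have "\<dots> \<le> op_norm (ampl p n \<Phi> (sign_block_mat n p M' \<epsilon>))"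
      unfolding \<Phi>_def P_def using signs p by (intro op_norm_ampl_corner_map_ge)
    finally show ?thesis
      by (simp add: N_def K_def real_sqrt_divide)
  qed
  ultimately have "ereal (1 / (6 * 360\<^sup>2) * sqrt (real n / real k)) \<le> cb_norm n \<Phi>"
    by (meson ereal_less_eq(3) order.trans)
  with kpos show ?thesis
    using linear_corner_map[OF p(2)] unital_corner_map[OF p(2)] assms unfolding \<Phi>_def by (intro exI[of _ "corner_map n p s \<epsilon>"]) auto
qed

lemma k_positive_id: "k_positive_Mn k n (\<lambda>X. X)"
proof -
  have "ampl k n (\<lambda>X. X) X = X" if "X \<in> carrier_mat (k * n) (k * n)" for X
  proof (rule eq_matI)
    fix a b assume "a < dim_row X" "b < dim_col X"
    then have ab: "a < k * n" "b < k * n"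
      using that by auto
    then have "n > 0"
      by (cases n) auto
    with ab show "ampl k n (\<lambda>X. X) X $$ (a, b) = X $$ (a, b)"
      by (simp add: ampl_def block_def)
  qed (use that in \<open>auto simp: ampl_def\<close>)
  then show ?thesis
    by (simp add: k_positive_Mn_def psd_mat_def)
qed

text \<open>In dimension one there is no off-diagonal corner, so the identity map is used
  there.\<close>

lemma one_le_cb_norm_id: "1 \<le> cb_norm 1 (\<lambda>X. X)"
proof -
  have "op_norm (1\<^sub>m 1) \<le> 1"
    by (rule op_norm_le) auto
  then have "ereal (op_norm (ampl 1 1 (\<lambda>X. X) (1\<^sub>m 1))) \<le> cb_norm 1 (\<lambda>X. X)"
    by (intro op_norm_le_cb_norm) auto
  moreover have "ampl 1 1 (\<lambda>X. X) (1\<^sub>m 1) = 1\<^sub>m 1"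
    by (rule eq_matI) (auto simp: ampl_def block_def)
  moreover have "1 \<le> op_norm (1\<^sub>m 1)"
    using vnorm_mult_le_op_norm[of "vec 1 (\<lambda>_. 1)" "1\<^sub>m 1"] by (simp add: vnorm_def)
  ultimately show ?thesis
    by (metis ereal_less_eq(3) one_ereal_def order.trans)
qed

theorem mainTheorem8:
  shows "\<exists>c :: real. c > 0 \<and>
    (\<forall>n k :: nat. 1 \<le> n \<longrightarrow> 1 \<le> k \<longrightarrow> k \<le> n \<longrightarrow>
       (\<exists>\<Phi>. linear_map_Mn n \<Phi> \<and> unital_Mn n \<Phi> \<and> k_positive_Mn k n \<Phi> \<and>
            cb_norm n \<Phi> \<ge> ereal (c * sqrt (real n / real k))))"
proof (intro exI[of _ "1 / (6 * 360\<^sup>2)"] conjI allI impI)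
  fix n k :: nat assume nk: "1 \<le> n" "1 \<le> k" "k \<le> n"
  show "\<exists>\<Phi>. linear_map_Mn n \<Phi> \<and> unital_Mn n \<Phi> \<and> k_positive_Mn k n \<Phi> \<and>
      cb_norm n \<Phi> \<ge> ereal (1 / (6 * 360\<^sup>2) * sqrt (real n / real k))"
  proof (cases "n = 1")
    case True
    then have "ereal (1 / (6 * 360\<^sup>2) * sqrt (real n / real k)) \<le> 1"
      using nk by simp
    also have "1 \<le> cb_norm n (\<lambda>X. X)"
      using one_le_cb_norm_id True by simp
    finally show ?thesis
      using k_positive_id[of k n] by (intro exI[of _ "\<lambda>X. X"]) (auto simp: linear_map_Mn_def unital_Mn_def)
  next
    case False
    then show ?thesis
      using exists_map_of_dim_ge_2[of n k] nk by simp
  qed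
qed simp

end
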